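(* Let $\mathfrak{O}$ be the valuation ring of a non-Archimedean local field $K$, let $q$ be the residue field size of $\mathfrak{O}$, and let $|\cdot|$ be the absolute value on $K$ with $|\pi| = q^{-1}$ for any uniformiser $\pi$. Let $\mathsf{A}$ be a (possibly non-associative) $\mathfrak{O}$-algebra whose underlying $\mathfrak{O}$-module is free with basis $a_1,\dots,a_d$. Let $0=\beta_1<\beta_2<\dots<\beta_{r+1}=d$ and set $\mathsf{A}_i=\mathfrak{O}a_{1+\beta_i}\oplus\dots\oplus\mathfrak{O}a_{\beta_{i+1}}$ for $i=1,\dots,r$, so that $\mathsf{A}=\mathsf{A}_1\oplus\dots\oplus\mathsf{A}_r$. Let $T$ be the $\mathfrak{O}$-module of block diagonal upper triangular $d\times d$ matrices over $\mathfrak{O}$ with diagonal blocks of sizes $\beta_2-\beta_1,\dots,\beta_{r+1}-\beta_r$, and let $M(\mathbf{X})$ be the generic matrix of this shape: $M(\mathbf{X})$ is block diagonal, its $i$-th diagonal block is the upper triangular matrix with entries $X_{a,b}$ for $1+\beta_i\le a\le b\le \beta_{i+1}$, and all other entries are $0$. Let $R=\mathfrak{O}[\mathbf{X}]$ (polynomial ring in these variables) and let $\star\colon R^d\times R^d\to R^d$ be the $R$-bilinear map obtained by base extension from the multiplication of $\mathsf{A}$ written in coordinates with respect to $a_1,\dots,a_d$. Let $F\subset R$ be the set of all entries of all row vectors $(M_i(\mathbf{X})\star M_j(\mathbf{X}))\,\mathrm{adj}(M(\mathbf{X}))$ for $1\le i,j\le d$, where $M_i(\mathbf{X})$ denotes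 the $i$-th row of $M(\mathbf{X})$ and $\mathrm{adj}$ denotes the adjugate matrix. Define $$V=\{\mathbf{x}\in T:\ \det(M(\mathbf{x}))\text{ divides } f(\mathbf{x}) \text{ in }\mathfrak{O}\text{ for all } f\in F\}.$$ Let $\mu$ be the normalised Haar measure on $T\cong\mathfrak{O}^{\sum_{i=1}^r\binom{\beta_{i+1}-\beta_i+1}{2}}$. Then $$\zeta^{\mathrm{gr}\le}_{\mathsf{A}}(s)=(1-q^{-1})^{-d}\int_V\prod_{i=1}^r\prod_{j=1}^{\beta_{i+1}-\beta_i}|x_{j+\beta_i,\,j+\beta_i}|^{s-j}\,d\mu(\mathbf{x}).$$
   Context: For a commutative ring $R$ and an $R$-algebra $\mathsf{A}$ with a decomposition $\mathsf{A}=\mathsf{A}_1\oplus\dots\oplus\mathsf{A}_r$ of $R$-modules (not required to be compatible with multiplication), an $R$-submodule $\mathsf{U}\le\mathsf{A}$ is homogeneous if $\mathsf{U}=\mathsf{U}_1\oplus\dots\oplus\mathsf{U}_r$ with $\mathsf{U}_i\le\mathsf{A}_i$ submodules. The graded subalgebra zeta function is $\zeta^{\mathrm{gr}\le}_{\mathsf{A}}(s)=\sum_{\mathsf{U}}[\mathsf{A}:\mathsf{U}]^{-s}$, the sum ranging over homogeneous $R$-subalgebras $\mathsf{U}$ (submodules closed under multiplication, not required to contain an identity) such that $\mathsf{A}/\mathsf{U}$ is finite, $[\mathsf{A}:\mathsf{U}]$ denoting its cardinality. The identity is one of functions of a complex variable $s$ where both sides converge (some right half-plane). *)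

theory Defs
  imports "Jordan_Normal_Form.Determinant" "HOL-Analysis.Set_Integral"
    "HOL-Analysis.Infinite_Sum" "HOL-Analysis.Complex_Transcendental" "HOL-Library.Function_Algebras"
begin

definition valring :: "('k::field \<Rightarrow> real) \<Rightarrow> 'k set" where
  "valring absv = {x. absv x \<le> 1}"

definition residue_classes :: "('k::field \<Rightarrow> real) \<Rightarrow> 'k set set" where
  "residue_classes absv =
     (\<lambda>x. {y \<in> valring absv. absv (y - x) < 1}) ` valring absv"

text \<open>absv is a normalised absolute value on a non-Archimedean local field with
  residue field of size q: a complete discretely valued field with finite residue
  field of cardinality q, normalised so that |pi| = 1/q for a uniformiser pi
  (equivalently the value group is q^Z and 1/q is attained).\<close>
definition nonarch_local_field :: "('k::field \<Rightarrow> real) \<Rightarrow> nat \<Rightarrow> bool" where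
  "nonarch_local_field absv q \<longleftrightarrow>
     (\<forall>x. absv x \<ge> 0) \<and> (\<forall>x. absv x = 0 \<longleftrightarrow> x = 0) \<and>
     (\<forall>x y. absv (x * y) = absv x * absv y) \<and>
     (\<forall>x y. absv (x + y) \<le> max (absv x) (absv y)) \<and>
     (\<exists>\<pi>. absv \<pi> = 1 / real q) \<and>
     (\<forall>x. x \<noteq> 0 \<longrightarrow> (\<exists>k::int. absv x = real q powr real_of_int k)) \<and>
     finite (residue_classes absv) \<and> card (residue_classes absv) = q \<and>
     (\<forall>f::nat \<Rightarrow> 'k.
        (\<forall>e>0. \<exists>N. \<forall>m\<ge>N. \<forall>n\<ge>N. absv (f m - f n) < e) \<longrightarrow>
        (\<exists>L. \<forall>e>0. \<exists>N. \<forall>n\<ge>N. absv (f n - L) < e))"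

text \<open>Elements of A are coordinate vectors w.r.t. the basis a_0,...,a_(d-1)
  (0-indexed), represented as functions nat => 'k vanishing from d on.\<close>
definition Acar :: "('k::field \<Rightarrow> real) \<Rightarrow> nat \<Rightarrow> (nat \<Rightarrow> 'k) set" where
  "Acar absv d = {v. (\<forall>i<d. v i \<in> valring absv) \<and> (\<forall>i\<ge>d. v i = 0)}"

text \<open>Multiplication: a_i a_j = sum_k c i j k a_k, extended bilinearly.  The same
  formula defines the base-extended bilinear map (star) on coordinate vectors.\<close>
definition mulA :: "nat \<Rightarrow> (nat \<Rightarrow> nat \<Rightarrow> nat \<Rightarrow> 'k::field) \<Rightarrow>
    (nat \<Rightarrow> 'k) \<Rightarrow> (nat \<Rightarrow> 'k) \<Rightarrow> nat \<Rightarrow> 'k" where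
  "mulA d c x y = (\<lambda>k. if k < d then (\<Sum>i<d. \<Sum>j<d. x i * y j * c i j k) else 0)"

definition is_submodule :: "('k::field \<Rightarrow> real) \<Rightarrow> nat \<Rightarrow> (nat \<Rightarrow> 'k) set \<Rightarrow> bool" where
  "is_submodule absv d U \<longleftrightarrow> U \<subseteq> Acar absv d \<and> 0 \<in> U \<and>
     (\<forall>u\<in>U. \<forall>v\<in>U. u + v \<in> U) \<and>
     (\<forall>a\<in>valring absv. \<forall>u\<in>U. (\<lambda>i. a * u i) \<in> U)"

definition Ablock :: "('k::field \<Rightarrow> real) \<Rightarrow> nat \<Rightarrow> (nat \<Rightarrow> nat) \<Rightarrow> nat \<Rightarrow> (nat \<Rightarrow> 'k) set" where
  "Ablock absv d \<beta> i = {v \<in> Acar absv d. \<forall>j. v j \<noteq> 0 \<longrightarrow> \<beta> i \<le> j \<and> j < \<beta> (Suc i)}"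

definition homogeneous ::
    "('k::field \<Rightarrow> real) \<Rightarrow> nat \<Rightarrow> (nat \<Rightarrow> nat) \<Rightarrow> nat \<Rightarrow> (nat \<Rightarrow> 'k) set \<Rightarrow> bool" where
  "homogeneous absv d \<beta> r U \<longleftrightarrow>
     (\<exists>Us. (\<forall>i<r. is_submodule absv d (Us i) \<and> Us i \<subseteq> Ablock absv d \<beta> i) \<and>
           U = {(\<Sum>i<r. u i) | u. \<forall>i<r. u i \<in> Us i})"

definition is_subalgebra ::
    "('k::field \<Rightarrow> real) \<Rightarrow> nat \<Rightarrow> (nat \<Rightarrow> nat \<Rightarrow> nat \<Rightarrow> 'k) \<Rightarrow> (nat \<Rightarrow> 'k) set \<Rightarrow> bool" where
  "is_subalgebra absv d c U \<longleftrightarrow> is_submodule absv d U \<and>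
     (\<forall>u\<in>U. \<forall>v\<in>U. mulA d c u v \<in> U)"

definition cosets :: "('k::field \<Rightarrow> real) \<Rightarrow> nat \<Rightarrow> (nat \<Rightarrow> 'k) set \<Rightarrow> (nat \<Rightarrow> 'k) set set" where
  "cosets absv d U = (\<lambda>x. (\<lambda>u. x + u) ` U) ` Acar absv d"

definition graded_subalgebras ::
    "('k::field \<Rightarrow> real) \<Rightarrow> nat \<Rightarrow> (nat \<Rightarrow> nat \<Rightarrow> nat \<Rightarrow> 'k) \<Rightarrow> (nat \<Rightarrow> nat) \<Rightarrow> nat
     \<Rightarrow> (nat \<Rightarrow> 'k) set set" where
  "graded_subalgebras absv d c \<beta> r =
     {U. is_subalgebra absv d c U \<and> homogeneous absv d \<beta> r U \<and> finite (cosets absv d U)}"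

definition zeta_term ::
    "('k::field \<Rightarrow> real) \<Rightarrow> nat \<Rightarrow> complex \<Rightarrow> (nat \<Rightarrow> 'k) set \<Rightarrow> complex" where
  "zeta_term absv d s U = (of_nat (card (cosets absv d U)) :: complex) powr (- s)"

definition Tidx :: "nat \<Rightarrow> (nat \<Rightarrow> nat) \<Rightarrow> nat \<Rightarrow> (nat \<times> nat) set" where
  "Tidx d \<beta> r = {(a, b). a \<le> b \<and> b < d \<and> (\<exists>i<r. \<beta> i \<le> a \<and> b < \<beta> (Suc i))}"

definition Tspace ::
    "('k::field \<Rightarrow> real) \<Rightarrow> nat \<Rightarrow> (nat \<Rightarrow> nat) \<Rightarrow> nat \<Rightarrow> (nat \<times> nat \<Rightarrow> 'k) set" where
  "Tspace absv d \<beta> r =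
     {x. (\<forall>p\<in>Tidx d \<beta> r. x p \<in> valring absv) \<and> (\<forall>p. p \<notin> Tidx d \<beta> r \<longrightarrow> x p = 0)}"

definition Mmat :: "nat \<Rightarrow> (nat \<times> nat \<Rightarrow> 'k::field) \<Rightarrow> 'k mat" where
  "Mmat d x = Matrix.mat d d x"

definition rowfun :: "nat \<Rightarrow> 'k mat \<Rightarrow> nat \<Rightarrow> nat \<Rightarrow> 'k::field" where
  "rowfun d A i = (\<lambda>t. if t < d then Matrix.row A i $ t else 0)"

text \<open>k-th entry of the row vector (M_i(x) star M_j(x)) adj(M(x)), i.e. the value at x
  of the polynomial f in F.\<close>
definition Fentry :: "nat \<Rightarrow> (nat \<Rightarrow> nat \<Rightarrow> nat \<Rightarrow> 'k::field) \<Rightarrow> (nat \<times> nat \<Rightarrow> 'k)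
    \<Rightarrow> nat \<Rightarrow> nat \<Rightarrow> nat \<Rightarrow> 'k" where
  "Fentry d c x i j k =
     (\<Sum>l<d. mulA d c (rowfun d (Mmat d x) i) (rowfun d (Mmat d x) j) l
              * Determinant.adj_mat (Mmat d x) $$ (l, k))"

definition Vset ::
    "('k::field \<Rightarrow> real) \<Rightarrow> nat \<Rightarrow> (nat \<Rightarrow> nat \<Rightarrow> nat \<Rightarrow> 'k) \<Rightarrow> (nat \<Rightarrow> nat) \<Rightarrow> nat
     \<Rightarrow> (nat \<times> nat \<Rightarrow> 'k) set" where
  "Vset absv d c \<beta> r = {x \<in> Tspace absv d \<beta> r.
     \<forall>i<d. \<forall>j<d. \<forall>k<d. \<exists>y\<in>valring absv. Fentry d c x i j k = Determinant.det (Mmat d x) * y}"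

definition Tballs ::
    "('k::field \<Rightarrow> real) \<Rightarrow> nat \<Rightarrow> (nat \<Rightarrow> nat) \<Rightarrow> nat \<Rightarrow> (nat \<times> nat \<Rightarrow> 'k) set set" where
  "Tballs absv d \<beta> r =
     {{y \<in> Tspace absv d \<beta> r. \<forall>p\<in>Tidx d \<beta> r. absv (y p - x p) \<le> e} | x e.
        x \<in> Tspace absv d \<beta> r \<and> e > 0}"

text \<open>M is a normalised Haar measure on the Borel sets of T (the sigma-algebra
  generated by the balls of the product ultrametric): translation invariant
  with total mass 1.\<close>
definition is_haar ::
    "('k::field \<Rightarrow> real) \<Rightarrow> nat \<Rightarrow> (nat \<Rightarrow> nat) \<Rightarrow> nat \<Rightarrow> (nat \<times> nat \<Rightarrow> 'k) measure \<Rightarrow> bool" where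
  "is_haar absv d \<beta> r M \<longleftrightarrow>
     space M = Tspace absv d \<beta> r \<and>
     sets M = sigma_sets (Tspace absv d \<beta> r) (Tballs absv d \<beta> r) \<and>
     emeasure M (Tspace absv d \<beta> r) = 1 \<and>
     (\<forall>a\<in>Tspace absv d \<beta> r. \<forall>A\<in>sets M. emeasure M ((\<lambda>y. y + a) ` A) = emeasure M A)"

text \<open>The integrand prod_i prod_(j=1..n_i) |x_(beta_i+j, beta_i+j)|^(s-j) (0-indexed
  positions beta i + j - 1).\<close>
definition integrand ::
    "('k::field \<Rightarrow> real) \<Rightarrow> (nat \<Rightarrow> nat) \<Rightarrow> nat \<Rightarrow> complex \<Rightarrow> (nat \<times> nat \<Rightarrow> 'k) \<Rightarrow> complex" where
  "integrand absv \<beta> r s x =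
     (\<Prod>i<r. \<Prod>j\<in>{1..\<beta> (Suc i) - \<beta> i}.
        complex_of_real (absv (x (\<beta> i + j - 1, \<beta> i + j - 1))) powr (s - of_nat j))"

end

theory Submission
  imports Defs
begin

text \<open>Sending a nondegenerate matrix \<open>x \<in> V\<close> to its row span is a surjection onto the graded
  subalgebras of finite index (Hermite normal form). Its fibre through \<open>m\<close> is the orbit of \<open>m\<close> under
  the invertible matrices of the same block triangular shape, and both the integrand and the index
  depend only on the absolute values of the diagonal, which are constant on the fibre. So the integral
  is the sum over subalgebras of integrand times measure of the fibre.

  Indices and measures both come from one fact about a triangular endomorphism \<open>L\<close> of a free module
  \<open>\<OO>\<^sup>I\<close> with diagonal entries \<open>D p\<close>: the module is the disjoint union of the translates
  \<open>y + L(\<OO>\<^sup>I)\<close>, where \<open>y\<close> runs through a product of residue systems modulo the \<open>D p\<close>.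
  Hence \<open>L(\<OO>\<^sup>I)\<close> has index \<open>\<Prod> |D p|\<^sup>-\<^sup>1\<close>, and by translation invariance Haar measure \<open>\<Prod> |D p|\<close>.
  The degenerate matrices contribute nothing because \<open>0 powr z = 0\<close>.\<close>

section \<open>Non-Archimedean local fields\<close>

text \<open>The exponent \<open>s - j\<close> is what makes the contributions of the fibres
  collapse. Right multiplication by \<open>m\<close> has diagonal entry \<open>m (b, b)\<close> at
  every position \<open>(a, b)\<close>, and the \<open>j\<close>-th column of a diagonal block has
  exactly \<open>j\<close> positions. So the fibre of \<open>m\<close> has measure proportional to
  the product of the |m (b, b)|^j; the integrand supplies |m (b, b)|^(s - j), and what remains is
  the product of the |m (b, b)|^s, which is the index to the power -s. The constant (1 - 1/q)^d is
  the measure of the matrices with unit diagonal: each of the \<open>d\<close> diagonal entries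
  avoids one of \<open>q\<close> residue classes.

  The measure is given only by translation invariance and total mass on a sigma-algebra generated by
  balls. Scaling is therefore derived by counting translates, and images are measurable because a
  submodule of finite index contains a ball and so is a finite union of balls. Countable additivity
  over the fibres requires countably many subalgebras; this is extracted from summability, since no
  term of the zeta series vanishes.\<close>

lemma sum_fun_app: "(\<Sum>j\<in>S. f j) x = (\<Sum>j\<in>S. f j x)"
  for f :: "'j \<Rightarrow> 'i \<Rightarrow> 'a::comm_monoid_add"
  by (induction S rule: infinite_finite_induct) auto

locale local_field =
  fixes absv :: "'k::field \<Rightarrow> real" and q :: nat
  assumes local_field: "nonarch_local_field absv q"
begin

lemmas local_field_conjs = local_field[unfolded nonarch_local_field_def]

lemma absv_nonneg [simp]: "absv x \<ge> 0"
  using local_field_conjs[THEN conjunct1] by simp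

lemma absv_eq_0 [simp]: "absv x = 0 \<longleftrightarrow> x = 0"
  using local_field_conjs[THEN conjunct2, THEN conjunct1] by simp

lemma absv_mult: "absv (x * y) = absv x * absv y"
  using local_field_conjs[THEN conjunct2, THEN conjunct2, THEN conjunct1] by simp

lemma absv_add_le_max: "absv (x + y) \<le> max (absv x) (absv y)"
  using local_field_conjs[THEN conjunct2, THEN conjunct2, THEN conjunct2, THEN conjunct1] by simp

lemma absv_pos [simp]: "absv x > 0 \<longleftrightarrow> x \<noteq> 0"
  using absv_nonneg[of x] absv_eq_0[of x] by linarith

lemma absv_0 [simp]: "absv 0 = 0"
  by simp

lemma absv_1 [simp]: "absv 1 = 1"
  using absv_mult[of 1 1] absv_eq_0[of 1] by auto

lemma absv_minus [simp]: "absv (- x) = absv x"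
proof -
  have "absv (-1) * absv (-1) = 1"
    using absv_mult[of "-1" "-1"] by simp
  then have "absv (-1) = 1"
    by (metis abs_of_nonneg absv_nonneg abs_mult_self_eq power2_eq_square real_sqrt_abs real_sqrt_one)
  then show ?thesis
    using absv_mult[of "-1" x] by simp
qed

lemma absv_divide: "absv (x / y) = absv x / absv y"
proof (cases "y = 0")
  case False
  then show ?thesis
    using absv_mult[of "x / y" y] by (simp add: field_simps)
qed simp

lemma absv_power: "absv (x ^ n) = absv x ^ n"
  by (induction n) (simp_all add: absv_mult)

lemma absv_prod: "absv (\<Prod>i\<in>S. f i) = (\<Prod>i\<in>S. absv (f i))"
  by (induction S rule: infinite_finite_induct) (simp_all add: absv_mult)

lemma absv_add_le: "absv x \<le> e \<Longrightarrow> absv y \<le> e \<Longrightarrow> absv (x + y) \<le> e"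
  using absv_add_le_max[of x y] by simp

lemma absv_diff_le: "absv x \<le> e \<Longrightarrow> absv y \<le> e \<Longrightarrow> absv (x - y) \<le> e"
  using absv_add_le[of x e "- y"] by simp

lemma absv_diff_le_trans: "absv (x - y) \<le> e \<Longrightarrow> absv (x - z) \<le> e \<Longrightarrow> absv (y - z) \<le> e"
  using absv_diff_le[of "x - z" e "x - y"] by (simp add: algebra_simps)

lemma absv_sum_le: "(\<And>i. i \<in> S \<Longrightarrow> absv (f i) \<le> e) \<Longrightarrow> 0 \<le> e \<Longrightarrow> absv (\<Sum>i\<in>S. f i) \<le> e"
  by (induction S rule: infinite_finite_induct) (auto intro: absv_add_le)

lemma absv_mult_le_1: "absv x \<le> 1 \<Longrightarrow> absv y \<le> 1 \<Longrightarrow> absv (x * y) \<le> 1"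
  by (simp add: absv_mult mult_le_one)

lemma valring_iff [simp]: "x \<in> valring absv \<longleftrightarrow> absv x \<le> 1"
  by (simp add: valring_def)

text \<open>The residue classes of 0 and 1 differ because 1 has absolute value 1. This is what makes
  1/q < 1.\<close>

lemma q_ge_2: "q \<ge> 2"
proof -
  define C where "C x = {y \<in> valring absv. absv (y - x) < 1}" for x
  have "C 0 \<in> residue_classes absv" "C 1 \<in> residue_classes absv"
    unfolding residue_classes_def C_def by (rule image_eqI[OF refl], simp)+
  moreover have "0 \<in> C 0" "0 \<notin> C 1"
    by (auto simp: C_def)
  ultimately have "card {C 0, C 1} = 2" "{C 0, C 1} \<subseteq> residue_classes absv"
    by (auto simp: card_2_iff)
  moreover have "finite (residue_classes absv)" "card (residue_classes absv) = q"
    using local_field unfolding nonarch_local_field_def by blast+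
  ultimately show ?thesis
    by (metis card_mono)
qed

definition unif :: 'k where
  "unif = (SOME p. absv p = 1 / real q)"

lemma absv_unif: "absv unif = 1 / real q"
proof -
  have "\<exists>p. absv p = 1 / real q"
    using local_field unfolding nonarch_local_field_def by blast
  then show ?thesis
    unfolding unif_def by (rule someI_ex)
qed

lemma unif_nonzero: "unif \<noteq> 0"
  using absv_unif q_ge_2 by (metis absv_0 divide_eq_0_iff of_nat_eq_0_iff one_neq_zero not_numeral_le_zero)

lemma absv_unif_less_1: "absv unif < 1"
  using q_ge_2 by (simp add: absv_unif)

text \<open>The value group is given through real powers of \<open>q\<close>; inside the valuation
  ring the exponent is at most 0, so a natural exponent remains, to which least-number arguments
  apply.\<close>

lemma absv_valring_eq_power:
  assumes "x \<noteq> 0" "absv x \<le> 1"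
  obtains n where "absv x = (1 / real q) ^ n"
proof -
  obtain k :: int where k: "absv x = real q powr real_of_int k"
    using local_field assms(1) unfolding nonarch_local_field_def by blast
  have "k \<le> 0"
  proof (rule ccontr)
    assume "\<not> k \<le> 0"
    then have "real q powr real_of_int k > real q powr 0"
      using q_ge_2 by (intro powr_less_mono) auto
    then show False
      using k assms(2) q_ge_2 by simp
  qed
  then have "absv x = real q powr (- real (nat (- k)))"
    using k by simp
  also have "\<dots> = (1 / real q) ^ nat (- k)"
    using q_ge_2 by (subst powr_minus, subst powr_realpow) (auto simp: power_one_over field_simps)
  finally show ?thesis
    by (rule that)
qed

text \<open>Discreteness of the valuation: there is no value between 1/q and 1. It turns the strict
  bound into a non-strict one, the form in which the ultrametric rules are stated.\<close>

lemma absv_less_1_iff: "absv x < 1 \<longleftrightarrow> absv x \<le> 1 / real q"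
proof
  assume x: "absv x < 1"
  show "absv x \<le> 1 / real q"
  proof (cases "x = 0")
    case False
    then obtain n where n: "absv x = (1 / real q) ^ n"
      using x absv_valring_eq_power by (metis less_imp_le)
    then obtain m where "n = Suc m"
      using x by (cases n) auto
    moreover have "(1 / real q) ^ m \<le> 1"
      using q_ge_2 by (intro power_le_one) auto
    ultimately show ?thesis
      using n q_ge_2 by (simp add: divide_right_mono)
  qed simp
next
  show "absv x \<le> 1 / real q \<Longrightarrow> absv x < 1"
    using absv_unif_less_1 unfolding absv_unif by linarith
qed

section \<open>Residue systems\<close>

text \<open>A complete residue system modulo the ideal generated by \<open>D\<close>. Membership in
  that ideal is expressed as |x| <= |D|, so only the absolute value of \<open>D\<close>
  matters.\<close>

definition reps :: "'k \<Rightarrow> 'k set \<Rightarrow> bool" where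
  "reps D R \<longleftrightarrow> finite R \<and> R \<subseteq> valring absv \<and>
     (\<forall>x\<in>valring absv. \<exists>!r\<in>R. absv (x - r) \<le> absv D)"

lemma reps_unit: "absv D = 1 \<Longrightarrow> reps D {0}"
  by (auto simp: reps_def)

lemma reps_unif:
  obtains R where "reps unif R" "card R = q" "0 \<in> R"
proof -
  define C where "C x = {y \<in> valring absv. absv (y - x) < 1}" for x
  \<comment> \<open>The class of 0 is forced to be represented by 0 itself, so that removing 0 later
    leaves exactly the representatives of the unit classes.\<close>
  define f where "f c = (if c = C 0 then 0 else SOME x. x \<in> valring absv \<and> c = C x)" for c
  have f: "f c \<in> valring absv \<and> c = C (f c)" if "c \<in> residue_classes absv" for c
  proof (cases "c = C 0")
    case False
    have "\<exists>x. x \<in> valring absv \<and> c = C x"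
      using that by (auto simp: residue_classes_def C_def)
    from someI_ex[OF this] show ?thesis
      using False by (simp add: f_def)
  qed (simp add: f_def)
  define R where "R = f ` residue_classes absv"
  have C: "C x \<in> residue_classes absv" if "x \<in> valring absv" for x
    using that by (auto simp: residue_classes_def C_def)
  have fin: "finite (residue_classes absv)" "card (residue_classes absv) = q"
    using local_field unfolding nonarch_local_field_def by blast+
  have inj: "inj_on f (residue_classes absv)"
    using f by (metis inj_onI)
  have eq: "C x = C y" if "x \<in> valring absv" "absv (x - y) < 1" for x y
  proof -
    have "absv (z - x) < 1 \<longleftrightarrow> absv (z - y) < 1" for z
      using that(2) absv_add_le[of "z - x" "1 / real q" "x - y"] absv_diff_le[of "z - y" "1 / real q" "x - y"]
      by (auto simp: absv_less_1_iff)
    then show ?thesis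
      by (auto simp: C_def)
  qed
  have "\<exists>!r\<in>R. absv (x - r) \<le> absv unif" if x: "x \<in> valring absv" for x
  proof (rule ex1I[of _ "f (C x)"])
    have "x \<in> C (f (C x))"
      using f[OF C[OF x]] x by (auto simp: C_def)
    then show "f (C x) \<in> R \<and> absv (x - f (C x)) \<le> absv unif"
      using C[OF x] by (simp add: R_def C_def absv_unif flip: absv_less_1_iff)
    fix r
    assume r: "r \<in> R \<and> absv (x - r) \<le> absv unif"
    then have "C x = C r"
      using x by (intro eq) (auto simp: absv_unif absv_less_1_iff)
    moreover obtain c where "c \<in> residue_classes absv" "r = f c"
      using r by (auto simp: R_def)
    ultimately show "r = f (C x)"
      using f by metis
  qed
  moreover have "R \<subseteq> valring absv"
    using f by (auto simp: R_def)
  ultimately have "reps unif R"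
    using fin by (auto simp: reps_def R_def)
  moreover have "card R = q"
    using inj fin by (simp add: R_def card_image)
  moreover have "0 \<in> R"
    unfolding R_def by (rule image_eqI[of _ _ "C 0"]) (use C[of 0] in \<open>auto simp: f_def\<close>)
  ultimately show ?thesis
    by (rule that)
qed

lemma reps_cong: "absv D = absv E \<Longrightarrow> reps D R \<longleftrightarrow> reps E R"
  by (simp add: reps_def)

lemma repsD: "reps D R \<Longrightarrow> x \<in> valring absv \<Longrightarrow> \<exists>r\<in>R. absv (x - r) \<le> absv D"
  by (auto simp: reps_def)

lemma repsD1: "reps D R \<Longrightarrow> r \<in> R \<Longrightarrow> absv r \<le> 1"
  by (auto simp: reps_def)

lemma reps_unique:
  assumes "reps D R" "r \<in> R" "r' \<in> R" "absv (r - r') \<le> absv D"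
  shows "r = r'"
proof -
  have "\<exists>!t\<in>R. absv (r - t) \<le> absv D"
    using assms by (auto simp: reps_def)
  then show ?thesis
    using assms by force
qed

text \<open>Digit expansion in base \<open>unif\<close>: a leading digit from a residue system
  modulo \<open>unif\<close>, plus \<open>unif\<close> times a representative modulo
  \<open>unif ^ n\<close>.\<close>

lemma reps_power:
  "\<exists>R. reps (unif ^ n) R \<and> card R = q ^ n"
proof (induction n)
  case 0
  show ?case
    using reps_unit[of 1] by (intro exI[of _ "{0}"]) auto
next
  case (Suc n)
  then obtain R where R: "reps (unif ^ n) R" "card R = q ^ n"
    by auto
  obtain R0 where R0: "reps unif R0" "card R0 = q"
    using reps_unif by metis
  let ?f = "\<lambda>(r, t). r + unif * t"
  have val: "r \<in> valring absv" "t \<in> valring absv" if "r \<in> R0" "t \<in> R" for r t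
    using that R R0 by (auto simp: reps_def)
  \<comment> \<open>Reduction modulo \<open>unif\<close> determines the leading digit; after
    cancelling it, division by \<open>unif\<close> gives a congruence modulo \<open>unif ^ n\<close>
    for the rest.\<close>
  have uniq: "r = r' \<and> t = t'"
    if "r \<in> R0" "t \<in> R" "r' \<in> R0" "t' \<in> R"
      "absv ((r + unif * t) - (r' + unif * t')) \<le> absv (unif ^ Suc n)" for r t r' t'
  proof
    have "absv (unif ^ Suc n) \<le> absv unif"
      using absv_unif_less_1 unfolding absv_power by (simp add: mult_left_le power_le_one)
    then have "absv ((r + unif * t) - (r' + unif * t')) \<le> absv unif"
      using that(5) by linarith
    moreover have "absv (unif * (t - t')) \<le> absv unif"
      using val[OF that(1,2)] val[OF that(3,4)] absv_diff_le[of t 1 t'] by (simp add: absv_mult mult_left_le)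
    ultimately have "absv (r - r') \<le> absv unif"
      using absv_diff_le[of "(r + unif * t) - (r' + unif * t')" _ "unif * (t - t')"]
      by (simp add: algebra_simps)
    then show "r = r'"
      using R0 that by (blast intro: reps_unique)
    then have "absv (unif * (t - t')) \<le> absv (unif ^ Suc n)"
      using that(5) by (simp add: algebra_simps)
    then have "absv (t - t') \<le> absv (unif ^ n)"
      using unif_nonzero by (simp add: absv_mult absv_power)
    then show "t = t'"
      using R that by (blast intro: reps_unique)
  qed
  have "reps (unif ^ Suc n) (?f ` (R0 \<times> R))"
    unfolding reps_def
  proof (intro conjI ballI)
    show "finite (?f ` (R0 \<times> R))"
      using R R0 by (auto simp: reps_def)
    show "?f ` (R0 \<times> R) \<subseteq> valring absv"
      using val absv_unif_less_1 by (fastforce intro!: absv_add_le absv_mult_le_1)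
    fix x
    assume "x \<in> valring absv"
    then obtain r where r: "r \<in> R0" "absv (x - r) \<le> absv unif"
      using repsD[OF R0(1)] by blast
    then have "(x - r) / unif \<in> valring absv"
      using unif_nonzero by (simp add: absv_divide)
    then obtain t where t: "t \<in> R" "absv ((x - r) / unif - t) \<le> absv (unif ^ n)"
      using repsD[OF R(1)] by blast
    have "x - (r + unif * t) = unif * ((x - r) / unif - t)"
      using unif_nonzero by (simp add: field_simps)
    then have xrt: "absv (x - (r + unif * t)) \<le> absv (unif ^ Suc n)"
      using t by (simp add: absv_mult mult_left_mono)
    show "\<exists>!y. y \<in> ?f ` (R0 \<times> R) \<and> absv (x - y) \<le> absv (unif ^ Suc n)"
    proof (rule ex1I[of _ "r + unif * t"])
      show "r + unif * t \<in> ?f ` (R0 \<times> R) \<and> absv (x - (r + unif * t)) \<le> absv (unif ^ Suc n)"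
        using r t xrt by force
      fix y
      assume "y \<in> ?f ` (R0 \<times> R) \<and> absv (x - y) \<le> absv (unif ^ Suc n)"
      then obtain r' t' where y: "r' \<in> R0" "t' \<in> R" "y = r' + unif * t'"
        "absv (x - (r' + unif * t')) \<le> absv (unif ^ Suc n)"
        by auto
      have "absv ((r' + unif * t') - (r + unif * t)) \<le> absv (unif ^ Suc n)"
        using absv_diff_le_trans[OF y(4) xrt] .
      then show "y = r + unif * t"
        using uniq[of r' t' r t] y r t by auto
    qed
  qed
  moreover have "inj_on ?f (R0 \<times> R)"
  proof (rule inj_onI, clarify)
    fix r t r' t'
    assume "r \<in> R0" "t \<in> R" "r' \<in> R0" "t' \<in> R" "r + unif * t = r' + unif * t'"
    then show "r = r' \<and> t = t'"
      using uniq[of r t r' t'] by simp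
  qed
  then have "card (?f ` (R0 \<times> R)) = q ^ Suc n"
    using R R0 by (simp add: card_image card_cartesian_product)
  ultimately show ?case
    by blast
qed

text \<open>If |D| = q^-n, then \<open>D\<close> and \<open>unif ^ n\<close> have the same residue
  systems, of size q^n.\<close>

lemma reps_exists:
  assumes "D \<noteq> 0" "absv D \<le> 1"
  obtains R where "reps D R" "real (card R) * absv D = 1"
proof -
  obtain n where n: "absv D = (1 / real q) ^ n"
    using absv_valring_eq_power assms by blast
  obtain R where "reps (unif ^ n) R" "card R = q ^ n"
    using reps_power by blast
  then show ?thesis
    using n q_ge_2 by (intro that[of R])
      (auto simp: absv_power absv_unif power_one_over reps_cong[of D "unif ^ n"])
qed

section \<open>Triangular endomorphisms of free modules\<close>

text \<open>The index type is arbitrary so that the algebra (indices below \<open>d\<close>) and the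
  matrix space (positions in \<open>Tidx\<close>) are instances of the same theory.\<close>

definition free_mod :: "'i set \<Rightarrow> ('i \<Rightarrow> 'k) set" where
  "free_mod I = {v. (\<forall>p\<in>I. v p \<in> valring absv) \<and> (\<forall>p. p \<notin> I \<longrightarrow> v p = 0)}"

lemma free_modI: "(\<And>p. p \<in> I \<Longrightarrow> absv (v p) \<le> 1) \<Longrightarrow> (\<And>p. p \<notin> I \<Longrightarrow> v p = 0) \<Longrightarrow> v \<in> free_mod I"
  by (auto simp: free_mod_def)

lemma free_mod_le: "v \<in> free_mod I \<Longrightarrow> absv (v p) \<le> 1"
  by (cases "p \<in> I") (auto simp: free_mod_def)

lemma free_mod_outside: "v \<in> free_mod I \<Longrightarrow> p \<notin> I \<Longrightarrow> v p = 0"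
  by (auto simp: free_mod_def)

lemma free_mod_0 [simp]: "0 \<in> free_mod I"
  and free_mod_add: "u \<in> free_mod I \<Longrightarrow> v \<in> free_mod I \<Longrightarrow> u + v \<in> free_mod I"
  and free_mod_diff: "u \<in> free_mod I \<Longrightarrow> v \<in> free_mod I \<Longrightarrow> u - v \<in> free_mod I"
  and free_mod_scale: "absv a \<le> 1 \<Longrightarrow> v \<in> free_mod I \<Longrightarrow> (\<lambda>p. a * v p) \<in> free_mod I"
  by (auto simp: free_mod_def intro: absv_add_le absv_diff_le absv_mult_le_1)

lemma Acar_eq_free_mod: "Acar absv d = free_mod {..<d}"
  by (auto simp: Acar_def free_mod_def)

lemma Tspace_eq_free_mod: "Tspace absv d \<beta> r = free_mod (Tidx d \<beta> r)"
  by (simp add: Tspace_def free_mod_def)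

text \<open>Only the partial order induced by the rank \<open>\<rho>\<close> matters, so that no linear order of the
  matrix positions has to be chosen.\<close>

definition triangular :: "'i set \<Rightarrow> ('i \<Rightarrow> nat) \<Rightarrow> ('i \<Rightarrow> 'k) \<Rightarrow> (('i \<Rightarrow> 'k) \<Rightarrow> 'i \<Rightarrow> 'k) \<Rightarrow> bool" where
  "triangular I \<rho> D L \<longleftrightarrow>
     (\<forall>p\<in>I. D p \<noteq> 0 \<and> absv (D p) \<le> 1) \<and>
     (\<forall>u\<in>free_mod I. L u \<in> free_mod I) \<and>
     (\<forall>u v. L (u + v) = L u + L v) \<and>
     (\<forall>a u. L (\<lambda>p. a * u p) = (\<lambda>p. a * L u p)) \<and>
     (\<forall>u\<in>free_mod I. \<forall>p\<in>I. (\<forall>p'\<in>I. \<rho> p' < \<rho> p \<longrightarrow> u p' = 0) \<longrightarrow> L u p = D p * u p)"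

definition box :: "'i set \<Rightarrow> ('i \<Rightarrow> 'k set) \<Rightarrow> ('i \<Rightarrow> 'k) set" where
  "box I R = {y \<in> free_mod I. \<forall>p\<in>I. y p \<in> R p}"

lemma card_box:
  assumes "finite I" "\<And>p. p \<in> I \<Longrightarrow> R p \<subseteq> valring absv"
  shows "card (box I R) = (\<Prod>p\<in>I. card (R p))"
proof -
  have "bij_betw (\<lambda>y. restrict y I) (box I R) (PiE I R)"
  proof (rule bij_betwI[of _ _ _ "\<lambda>f p. if p \<in> I then f p else 0"])
    show "(\<lambda>f p. if p \<in> I then f p else 0) \<in> PiE I R \<rightarrow> box I R"
      using assms(2) by (fastforce simp: box_def free_mod_def)
  qed (auto simp: box_def free_mod_def fun_eq_iff PiE_def extensional_def)
  then show ?thesis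
    using assms(1) by (simp add: bij_betw_same_card card_PiE)
qed

lemma finite_box:
  assumes "finite I" "\<And>p. p \<in> I \<Longrightarrow> finite (R p)"
  shows "finite (box I R)"
proof -
  have "box I R \<subseteq> (\<lambda>f p. if p \<in> I then f p else 0) ` PiE I R"
  proof
    fix y
    assume y: "y \<in> box I R"
    then show "y \<in> (\<lambda>f p. if p \<in> I then f p else 0) ` PiE I R"
      by (intro image_eqI[of _ _ "restrict y I"]) (auto simp: box_def free_mod_def fun_eq_iff)
  qed
  then show ?thesis
    using assms by (meson finite_PiE finite_imageI finite_subset)
qed

section \<open>Tiling a free module by translates of a triangular image\<close>

context
  fixes I :: "'i set" and \<rho> D L
  assumes tri: "triangular I \<rho> D L"
begin

lemma triangular_D: "p \<in> I \<Longrightarrow> D p \<noteq> 0" "p \<in> I \<Longrightarrow> absv (D p) \<le> 1"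
  and triangular_mem: "u \<in> free_mod I \<Longrightarrow> L u \<in> free_mod I"
  and triangular_add: "L (u + v) = L u + L v"
  and triangular_scale: "L (\<lambda>p. a * u p) = (\<lambda>p. a * L u p)"
  and triangular_diag: "u \<in> free_mod I \<Longrightarrow> p \<in> I \<Longrightarrow>
    (\<And>p'. p' \<in> I \<Longrightarrow> \<rho> p' < \<rho> p \<Longrightarrow> u p' = 0) \<Longrightarrow> L u p = D p * u p"
  using tri unfolding triangular_def by blast+

lemma triangular_diff: "L (u - v) = L u - L v"
  using triangular_add[of "u - v" v] by (simp add: algebra_simps)

lemma triangular_0: "L 0 = 0"
  using triangular_diff[of 0 0] by simp

text \<open>Division with remainder, carried out by increasing rank: at stage \<open>n\<close> the
  equation holds at all positions of rank below \<open>n\<close>.\<close>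

lemma triangular_decompose:
  assumes fin: "finite I" and R: "\<And>p. p \<in> I \<Longrightarrow> reps (D p) (R p)" and z: "z \<in> free_mod I"
  obtains y u where "y \<in> box I R" "u \<in> free_mod I" "z = y + L u"
proof -
  have "\<exists>y u. y \<in> box I R \<and> u \<in> free_mod I \<and> (\<forall>p\<in>I. \<rho> p < n \<longrightarrow> z p = y p + L u p)" for n
  proof (induction n)
    case 0
    have "\<forall>p\<in>I. \<exists>t. t \<in> R p"
      using R repsD[of _ _ 0] by (metis free_mod_0 free_mod_le valring_iff zero_fun_apply)
    then obtain g where g: "\<And>p. p \<in> I \<Longrightarrow> g p \<in> R p"
      by metis
    then have "(\<lambda>p. if p \<in> I then g p else 0) \<in> box I R"
      using repsD1[OF R] by (auto simp: box_def free_mod_def)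
    then show ?case
      using free_mod_0 by blast
  next
    case (Suc n)
    then obtain y u where y: "y \<in> box I R" and u: "u \<in> free_mod I"
      and eq: "\<And>p. p \<in> I \<Longrightarrow> \<rho> p < n \<Longrightarrow> z p = y p + L u p"
      by blast
    have "\<exists>t\<in>R p. absv ((z p - L u p) - t) \<le> absv (D p)" if "p \<in> I" for p
      using repsD[OF R[OF that], of "z p - L u p"] free_mod_le[OF z, of p] free_mod_le[OF triangular_mem[OF u], of p]
      by (auto intro: absv_diff_le)
    then obtain g where g: "\<And>p. p \<in> I \<Longrightarrow> g p \<in> R p"
      "\<And>p. p \<in> I \<Longrightarrow> absv ((z p - L u p) - g p) \<le> absv (D p)"
      by metis
    \<comment> \<open>The correction is supported on rank exactly \<open>n\<close>. By triangularity
      \<open>L e\<close> vanishes at lower ranks and equals \<open>D p * e p\<close> at rank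
      \<open>n\<close>, so positions already settled are not disturbed.\<close>
    define e where "e p = (if p \<in> I \<and> \<rho> p = n then (z p - L u p - g p) / D p else 0)" for p
    define y' where "y' p = (if p \<in> I \<and> \<rho> p = n then g p else y p)" for p
    have e: "e \<in> free_mod I"
      using g triangular_D by (intro free_modI) (auto simp: e_def absv_divide)
    have "y' \<in> box I R"
      using y g(1) repsD1[OF R] by (auto simp: box_def y'_def free_mod_def)
    moreover have "u + e \<in> free_mod I"
      using u e by (rule free_mod_add)
    moreover have "z p = y' p + L (u + e) p" if p: "p \<in> I" "\<rho> p < Suc n" for p
    proof -
      have "L e p = D p * e p"
        using p by (intro triangular_diag e) (auto simp: e_def)
      then show ?thesis
        using eq[OF p(1)] p triangular_D(1)[OF p(1)] by (auto simp: triangular_add y'_def e_def less_Suc_eq)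
    qed
    ultimately show ?case
      by blast
  qed
  \<comment> \<open>The sum of all ranks is a crude bound for each of them, so one more than it
    covers every position.\<close>
  from this[of "Suc (\<Sum>p\<in>I. \<rho> p)"] obtain y u where y: "y \<in> box I R" and u: "u \<in> free_mod I"
    and eq: "\<And>p. p \<in> I \<Longrightarrow> \<rho> p < Suc (\<Sum>p\<in>I. \<rho> p) \<Longrightarrow> z p = y p + L u p"
    by blast
  have "z = y + L u"
  proof
    fix p
    show "z p = (y + L u) p"
    proof (cases "p \<in> I")
      case True
      then show ?thesis
        using eq[of p] member_le_sum[of p I \<rho>] fin by (auto simp: less_Suc_eq_le)
    next
      case False
      then show ?thesis
        using y z triangular_mem[OF u] by (auto simp: box_def free_mod_outside)
    qed
  qed
  with y u show ?thesis
    by (rule that)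
qed

text \<open>Induction on the rank: once \<open>u\<close> and \<open>u'\<close> agree at lower ranks,
  \<open>y' p - y p\<close> equals \<open>D p * (u p - u' p)\<close>. It is thus divisible by
  \<open>D p\<close>, so the two representatives coincide, and cancelling \<open>D p\<close> gives
  \<open>u p = u' p\<close>.\<close>

lemma triangular_unique:
  assumes R: "\<And>p. p \<in> I \<Longrightarrow> reps (D p) (R p)"
    and y: "y \<in> box I R" "y' \<in> box I R" and u: "u \<in> free_mod I" "u' \<in> free_mod I"
    and eq: "y + L u = y' + L u'"
  shows "y = y' \<and> u = u'"
proof -
  have pw: "y p = y' p \<and> u p = u' p" if "p \<in> I" for p
    using that
  proof (induction "\<rho> p" arbitrary: p rule: less_induct)
    case less
    have "L (u - u') p = D p * (u - u') p"
      using less by (intro triangular_diag free_mod_diff u) auto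
    then have d: "y' p - y p = D p * (u p - u' p)"
      using fun_cong[OF eq, of p] unfolding triangular_diff
      by (simp add: right_diff_distrib) (metis add.commute add_diff_cancel_left' add_diff_eq diff_add_eq)
    have "absv (u p - u' p) \<le> 1"
      using u by (intro absv_diff_le) (auto intro: free_mod_le)
    then have "absv (y' p - y p) \<le> absv (D p)"
      unfolding d by (simp add: absv_mult mult_left_le)
    then have "y' p = y p"
      using y less.prems by (intro reps_unique[OF R[OF less.prems]]) (auto simp: box_def)
    with d show ?case
      using triangular_D(1)[OF less.prems] by simp
  qed
  have "y p = y' p \<and> u p = u' p" for p
    using pw[of p] y u by (cases "p \<in> I") (auto simp: box_def free_mod_outside)
  then show ?thesis
    by auto
qed

lemma triangular_reps:
  obtains R where "\<And>p. p \<in> I \<Longrightarrow> reps (D p) (R p)" "\<And>p. p \<in> I \<Longrightarrow> real (card (R p)) * absv (D p) = 1"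
proof -
  have "\<forall>p\<in>I. \<exists>R. reps (D p) R \<and> real (card R) * absv (D p) = 1"
    using reps_exists triangular_D by metis
  then show ?thesis
    using that by metis
qed

lemma triangular_card_box:
  assumes "finite I" "\<And>p. p \<in> I \<Longrightarrow> reps (D p) (R p)" "\<And>p. p \<in> I \<Longrightarrow> real (card (R p)) * absv (D p) = 1"
  shows "finite (box I R)" "real (card (box I R)) * (\<Prod>p\<in>I. absv (D p)) = 1"
proof -
  show "finite (box I R)"
    using assms by (intro finite_box) (auto simp: reps_def)
  have "card (box I R) = (\<Prod>p\<in>I. card (R p))"
    using assms by (intro card_box) (auto simp: reps_def)
  then show "real (card (box I R)) * (\<Prod>p\<in>I. absv (D p)) = 1"
    using assms(3) by (simp flip: prod.distrib)
qed

text \<open>Adding one and the same element of a box to both sides reduces this to the uniqueness of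
  the decomposition.\<close>

lemma triangular_inj: "inj_on L (free_mod I)"
proof (rule inj_onI)
  fix u u'
  assume *: "u \<in> free_mod I" "u' \<in> free_mod I" "L u = L u'"
  obtain R where R: "\<And>p. p \<in> I \<Longrightarrow> reps (D p) (R p)"
    using triangular_reps by metis
  then have "\<forall>p\<in>I. \<exists>t. t \<in> R p"
    using repsD[of _ _ 0] by (metis free_mod_0 free_mod_le valring_iff zero_fun_apply)
  then obtain g where g: "\<And>p. p \<in> I \<Longrightarrow> g p \<in> R p"
    by metis
  define y where "y p = (if p \<in> I then g p else 0)" for p
  have "y \<in> box I R"
    using g repsD1[OF R] by (auto simp: y_def box_def free_mod_def)
  then show "u = u'"
    using triangular_unique[OF R, of y y u u'] * by simp
qed

text \<open>Modulo a unit the residue system is {0}, so the remainder in the decomposition is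
  0.\<close>

lemma triangular_surj:
  assumes "finite I" "\<And>p. p \<in> I \<Longrightarrow> absv (D p) = 1" "z \<in> free_mod I"
  obtains u where "u \<in> free_mod I" "L u = z"
proof -
  obtain y u where y: "y \<in> box I (\<lambda>_. {0})" and u: "u \<in> free_mod I" "z = y + L u"
    using triangular_decompose[OF assms(1) _ assms(3), of "\<lambda>_. {0}"] assms(2) reps_unit by metis
  from y have "y = 0"
    by (auto simp: box_def free_mod_def fun_eq_iff)
  then show ?thesis
    using u that by auto
qed

text \<open>The elements of a box are coset representatives: the decomposition shows that they meet
  every coset, uniqueness that they meet it once.\<close>

lemma triangular_index:
  assumes "finite I"
  defines "Q \<equiv> (\<lambda>x. (\<lambda>u. x + u) ` (L ` free_mod I)) ` free_mod I"
  shows "finite Q" "real (card Q) * (\<Prod>p\<in>I. absv (D p)) = 1"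
proof -
  obtain R where R: "\<And>p. p \<in> I \<Longrightarrow> reps (D p) (R p)" "\<And>p. p \<in> I \<Longrightarrow> real (card (R p)) * absv (D p) = 1"
    using triangular_reps by metis
  let ?C = "\<lambda>x. (\<lambda>u. x + u) ` (L ` free_mod I)"
  have coset: "?C (y + L u) = ?C y" if "u \<in> free_mod I" for y u
  proof -
    have "(y + L u) + L v = y + L (u + v)" "y + L v = (y + L u) + L (v - u)" for v
      by (simp_all add: triangular_add triangular_diff algebra_simps)
    note shift = this
    show ?thesis
      unfolding image_image
    proof (intro equalityI image_subsetI)
      fix v
      assume v: "v \<in> free_mod I"
      show "(y + L u) + L v \<in> (\<lambda>v. y + L v) ` free_mod I"
        by (rule image_eqI[where x = "u + v"]) (rule shift(1), rule free_mod_add[OF that v])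
      show "y + L v \<in> (\<lambda>v. (y + L u) + L v) ` free_mod I"
        by (rule image_eqI[where x = "v - u"]) (rule shift(2), rule free_mod_diff[OF v that])
    qed
  qed
  have "Q = ?C ` box I R"
  proof
    show "Q \<subseteq> ?C ` box I R"
    proof
      fix X
      assume "X \<in> Q"
      then obtain z where z: "z \<in> free_mod I" "X = ?C z"
        by (auto simp: Q_def)
      obtain y u where "y \<in> box I R" "u \<in> free_mod I" "z = y + L u"
        using triangular_decompose[OF assms(1) R(1) z(1)] by metis
      then show "X \<in> ?C ` box I R"
        using coset z by blast
    qed
    show "?C ` box I R \<subseteq> Q"
      unfolding Q_def by (rule image_mono) (auto simp: box_def)
  qed
  moreover have "inj_on ?C (box I R)"
  proof (rule inj_onI)
    fix y y'
    assume y: "y \<in> box I R" "y' \<in> box I R" and eq: "?C y = ?C y'"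
    have "y + L 0 \<in> ?C y"
      by (intro imageI free_mod_0)
    then have "y + L 0 \<in> ?C y'"
      unfolding eq .
    then obtain u where "u \<in> free_mod I" "y + L 0 = y' + L u"
      by (elim imageE) metis
    then show "y = y'"
      using triangular_unique[OF R(1) y, of 0 u] by simp
  qed
  ultimately show "finite Q" "real (card Q) * (\<Prod>p\<in>I. absv (D p)) = 1"
    using triangular_card_box[OF assms(1) R] by (simp_all add: card_image)
qed

end

text \<open>Both maps must respect the same rank. It is used to combine right multiplication by a
  matrix with the scaling of the diagonal by \<open>unif\<close>.\<close>

lemma triangular_comp:
  assumes L: "triangular I \<rho> D L" and L': "triangular I \<rho> D' L'"
  shows "triangular I \<rho> (\<lambda>p. D p * D' p) (L \<circ> L')"
  unfolding triangular_def
proof (intro conjI ballI allI impI)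
  fix p
  assume "p \<in> I"
  then show "D p * D' p \<noteq> 0" "absv (D p * D' p) \<le> 1"
    using triangular_D[OF L] triangular_D[OF L'] by (auto intro: absv_mult_le_1)
next
  fix u p
  assume u: "u \<in> free_mod I" and p: "p \<in> I" and low: "\<forall>p'\<in>I. \<rho> p' < \<rho> p \<longrightarrow> u p' = 0"
  have "L' u p' = 0" if "p' \<in> I" "\<rho> p' < \<rho> p" for p'
    using triangular_diag[OF L' u that(1)] low that by auto
  then have "L (L' u) p = D p * L' u p"
    using triangular_diag[OF L triangular_mem[OF L' u] p] by auto
  then show "(L \<circ> L') u p = D p * D' p * u p"
    using triangular_diag[OF L' u p] low by auto
qed (auto simp: triangular_mem[OF L] triangular_mem[OF L'] triangular_add[OF L] triangular_add[OF L']
    triangular_scale[OF L] triangular_scale[OF L'])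

lemma triangular_scaling:
  assumes "\<And>p. p \<in> I \<Longrightarrow> D p \<noteq> 0" "\<And>p. p \<in> I \<Longrightarrow> absv (D p) \<le> 1"
  shows "triangular I \<rho> D (\<lambda>u p. D p * u p)"
  using assms unfolding triangular_def
  by (auto simp: free_mod_def algebra_simps intro: absv_mult_le_1)

section \<open>Submodules of finite index\<close>

definition submod :: "'i set \<Rightarrow> ('i \<Rightarrow> 'k) set \<Rightarrow> bool" where
  "submod I H \<longleftrightarrow> H \<subseteq> free_mod I \<and> 0 \<in> H \<and> (\<forall>u\<in>H. \<forall>v\<in>H. u + v \<in> H) \<and>
     (\<forall>a\<in>valring absv. \<forall>u\<in>H. (\<lambda>i. a * u i) \<in> H)"

lemma is_submodule_iff_submod: "is_submodule absv d U \<longleftrightarrow> submod {..<d} U"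
  by (simp add: is_submodule_def submod_def Acar_eq_free_mod)

lemma submod_sub: "submod I H \<Longrightarrow> u \<in> H \<Longrightarrow> u \<in> free_mod I"
  and submod_0: "submod I H \<Longrightarrow> 0 \<in> H"
  and submod_add: "submod I H \<Longrightarrow> u \<in> H \<Longrightarrow> v \<in> H \<Longrightarrow> u + v \<in> H"
  and submod_scale: "submod I H \<Longrightarrow> absv a \<le> 1 \<Longrightarrow> u \<in> H \<Longrightarrow> (\<lambda>i. a * u i) \<in> H"
  by (auto simp: submod_def)

lemma submod_diff:
  assumes "submod I H" "u \<in> H" "v \<in> H"
  shows "u - v \<in> H"
proof -
  have "u + (\<lambda>i. (-1) * v i) \<in> H"
    using assms by (intro submod_add submod_scale) auto
  moreover have "u + (\<lambda>i. (-1) * v i) = u - v"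
    by auto
  ultimately show ?thesis
    by simp
qed

lemma submod_sum: "submod I H \<Longrightarrow> (\<And>j. j \<in> S \<Longrightarrow> f j \<in> H) \<Longrightarrow> (\<Sum>j\<in>S. f j) \<in> H"
  by (induction S rule: infinite_finite_induct) (auto intro: submod_add submod_0)

lemma submod_image:
  assumes "triangular I \<rho> D L"
  shows "submod I (L ` free_mod I)"
  unfolding submod_def
proof (intro conjI ballI)
  show "L ` free_mod I \<subseteq> free_mod I"
    using triangular_mem[OF assms] by blast
  show "0 \<in> L ` free_mod I"
    by (rule image_eqI[of _ _ 0]) (simp_all add: triangular_0[OF assms])
next
  fix u v
  assume "u \<in> L ` free_mod I" "v \<in> L ` free_mod I"
  then obtain u' v' where "u' \<in> free_mod I" "v' \<in> free_mod I" "u = L u'" "v = L v'"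
    by (elim imageE)
  then show "u + v \<in> L ` free_mod I"
    by (intro image_eqI[of _ _ "u' + v'"] free_mod_add) (simp_all add: triangular_add[OF assms])
next
  fix a u
  assume "a \<in> valring absv" "u \<in> L ` free_mod I"
  then obtain u' where "u' \<in> free_mod I" "u = L u'" "absv a \<le> 1"
    by (elim imageE) auto
  then show "(\<lambda>i. a * u i) \<in> L ` free_mod I"
    by (intro image_eqI[of _ _ "\<lambda>i. a * u' i"] free_mod_scale)
      (simp_all add: triangular_scale[OF assms])
qed

lemma unif_power_inj: "unif ^ m = unif ^ n \<Longrightarrow> m = n"
proof (rule ccontr)
  assume eq: "unif ^ m = unif ^ n" and "m \<noteq> n"
  have "absv unif ^ m \<noteq> absv unif ^ n" if "m < n" for m n
  proof -
    have "absv unif ^ n < absv unif ^ m"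
      by (rule power_strict_decreasing[OF that _ absv_unif_less_1]) (simp add: unif_nonzero)
    then show ?thesis
      by simp
  qed
  with \<open>m \<noteq> n\<close> have "absv unif ^ m \<noteq> absv unif ^ n"
    by (metis linorder_neqE_nat)
  with eq show False
    by (metis absv_power)
qed

text \<open>Two of the infinitely many powers of a uniformiser times a basis vector lie in the same
  coset, so their difference is a nonzero multiple of that basis vector.\<close>

lemma submod_contains_multiple:
  assumes H: "submod I H" and fin: "finite ((\<lambda>x. (\<lambda>u. x + u) ` H) ` free_mod I)" and p: "p \<in> I"
  obtains a where "a \<noteq> 0" "absv a \<le> 1" "(\<lambda>i. if i = p then a else 0) \<in> H"
proof -
  define e where "e n = (\<lambda>i. if i = p then unif ^ n else 0)" for n :: nat
  have e: "e n \<in> free_mod I" for n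
    using p absv_unif_less_1 by (intro free_modI) (auto simp: e_def absv_power power_le_one)
  let ?f = "\<lambda>n. (\<lambda>u. e n + u) ` H"
  have "range ?f \<subseteq> (\<lambda>x. (\<lambda>u. x + u) ` H) ` free_mod I"
    using e by blast
  then have "finite (range ?f)"
    using fin finite_subset by blast
  then have "\<not> inj ?f"
    using range_inj_infinite by blast
  then obtain m n where mn: "m \<noteq> n" "?f m = ?f n"
    unfolding inj_on_def by blast
  have "e m + 0 \<in> ?f m"
    using submod_0[OF H] by (rule imageI)
  then obtain h where h: "h \<in> H" "e m + 0 = e n + h"
    unfolding mn(2) by (elim imageE)
  then have "h = e m - e n"
    by (metis add.right_neutral add_diff_cancel_left')
  also have "\<dots> = (\<lambda>i. if i = p then unif ^ m - unif ^ n else 0)"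
    by (auto simp: e_def)
  finally have "(\<lambda>i. if i = p then unif ^ m - unif ^ n else 0) \<in> H"
    using h by simp
  moreover have "unif ^ m - unif ^ n \<noteq> 0"
    using unif_power_inj mn(1) by auto
  moreover have "absv (unif ^ m - unif ^ n) \<le> 1"
    using absv_unif_less_1 by (intro absv_diff_le) (auto simp: absv_power power_le_one)
  ultimately show ?thesis
    using that by blast
qed

text \<open>The product of the multipliers found for the single coordinates serves as a common
  multiple. The conclusion says that a submodule of finite index is open, which will give
  measurability.\<close>

lemma submod_contains_scaled_free_mod:
  assumes "finite I" and H: "submod I H" and "finite ((\<lambda>x. (\<lambda>u. x + u) ` H) ` free_mod I)"
  obtains \<delta> where "\<delta> \<noteq> 0" "absv \<delta> \<le> 1" "\<And>t. t \<in> free_mod I \<Longrightarrow> (\<lambda>i. \<delta> * t i) \<in> H"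
proof -
  have "\<forall>p\<in>I. \<exists>a. a \<noteq> 0 \<and> absv a \<le> 1 \<and> (\<lambda>i. if i = p then a else 0) \<in> H"
    using submod_contains_multiple[OF assms(2,3)] by metis
  then obtain a where a: "\<And>p. p \<in> I \<Longrightarrow> a p \<noteq> 0" "\<And>p. p \<in> I \<Longrightarrow> absv (a p) \<le> 1"
    "\<And>p. p \<in> I \<Longrightarrow> (\<lambda>i. if i = p then a p else 0) \<in> H"
    by metis
  show ?thesis
  proof (rule that[of "\<Prod>p\<in>I. a p"])
    show "(\<Prod>p\<in>I. a p) \<noteq> 0"
      using a assms(1) by simp
    show "absv (\<Prod>p\<in>I. a p) \<le> 1"
      using a by (auto simp: absv_prod intro: prod_le_1)
    fix t
    assume t: "t \<in> free_mod I"
    \<comment> \<open>The product of all \<open>a i\<close> splits off the factor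
      \<open>a p\<close>; the other factors and \<open>t p\<close> form an integral coefficient of
      the \<open>p\<close>-th vector known to lie in \<open>H\<close>.\<close>
    define b where "b p = (\<Prod>i\<in>I - {p}. a i) * t p" for p
    have "(\<lambda>i. (\<Prod>p\<in>I. a p) * t i) = (\<Sum>p\<in>I. (\<lambda>i. b p * (if i = p then a p else 0)))"
    proof
      fix i
      show "(\<Prod>p\<in>I. a p) * t i = (\<Sum>p\<in>I. (\<lambda>i. b p * (if i = p then a p else 0))) i"
      proof (cases "i \<in> I")
        case True
        then have "(\<Sum>p\<in>I. b p * (if i = p then a p else 0)) = b i * a i"
          using assms(1) by (simp add: if_distrib sum.delta cong: if_cong)
        also have "\<dots> = (\<Prod>p\<in>I. a p) * t i"
          using prod.remove[OF assms(1) True, of a] by (simp add: b_def)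
        finally show ?thesis
          by (simp add: sum_fun_app)
      next
        case False
        then have "(\<Sum>p\<in>I. b p * (if i = p then a p else 0)) = 0"
          by (intro sum.neutral) auto
        then show ?thesis
          using False t by (simp add: sum_fun_app free_mod_outside)
      qed
    qed
    also have "\<dots> \<in> H"
    proof (intro submod_sum[OF H] submod_scale[OF H] a(3))
      fix p
      show "absv (b p) \<le> 1"
        unfolding b_def using a free_mod_le[OF t]
        by (auto simp: absv_prod intro!: absv_mult_le_1 prod_le_1)
    qed
    finally show "(\<lambda>i. (\<Prod>p\<in>I. a p) * t i) \<in> H" .
  qed
qed

lemma finite_Tidx: "finite (Tidx d \<beta> r)"
  by (rule finite_subset[of _ "{..<d} \<times> {..<d}"]) (auto simp: Tidx_def)

end

section \<open>Haar measure of triangular images\<close>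

locale block_structure = local_field absv q
  for absv :: "'k::field \<Rightarrow> real" and q +
  fixes d r :: nat and \<beta> :: "nat \<Rightarrow> nat"
  assumes \<beta>_0: "\<beta> 0 = 0" and \<beta>_less: "\<And>i. i < r \<Longrightarrow> \<beta> i < \<beta> (Suc i)" and \<beta>_r: "\<beta> r = d"
begin

abbreviation I where "I \<equiv> Tidx d \<beta> r"

abbreviation T where "T \<equiv> free_mod I"

end

locale haar_measure = block_structure absv q d r \<beta>
  for absv :: "'k::field \<Rightarrow> real" and q d r \<beta> +
  fixes M :: "(nat \<times> nat \<Rightarrow> 'k) measure"
  assumes haar: "is_haar absv d \<beta> r M"
begin

lemma space_M: "space M = T"
  and sets_M: "sets M = sigma_sets T (Tballs absv d \<beta> r)"
  and emeasure_T: "emeasure M T = 1"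
  using haar by (simp_all add: is_haar_def Tspace_eq_free_mod)

lemma emeasure_translate: "a \<in> T \<Longrightarrow> A \<in> sets M \<Longrightarrow> emeasure M ((\<lambda>y. y + a) ` A) = emeasure M A"
  using haar unfolding is_haar_def Tspace_eq_free_mod by blast

sublocale M: finite_measure M
  by (rule finite_measureI) (simp add: space_M emeasure_T)

text \<open>Stability under adding \<delta> times \<open>T\<close> makes \<open>A\<close> a union of
  balls of radius |\<delta>|. There are only finitely many such balls, because the residue ring
  modulo \<delta> is finite and \<open>I\<close> is finite.\<close>

lemma sets_M_open:
  assumes "A \<subseteq> T" "\<delta> \<noteq> 0" "absv \<delta> \<le> 1" and A: "\<And>x t. x \<in> A \<Longrightarrow> t \<in> T \<Longrightarrow> x + (\<lambda>i. \<delta> * t i) \<in> A"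
  shows "A \<in> sets M"
proof -
  define B where "B x = {y \<in> T. \<forall>p\<in>I. absv (y p - x p) \<le> absv \<delta>}" for x
  have B: "B x \<in> sets M" if "x \<in> T" for x
    unfolding sets_M Tballs_def B_def Tspace_eq_free_mod using that assms(2)
    by (intro sigma_sets.Basic CollectI exI[of _ x] exI[of _ "absv \<delta>"]) auto
  \<comment> \<open>Scaling by \<delta> is diagonal, so a constant rank works; the associated box
    provides a finite set of centres.\<close>
  have tri: "triangular I (\<lambda>_. 0) (\<lambda>_. \<delta>) (\<lambda>u p. \<delta> * u p)"
    using assms by (intro triangular_scaling)
  obtain R where R: "\<And>p. p \<in> I \<Longrightarrow> reps \<delta> (R p)"
    using triangular_reps[OF tri] by metis
  \<comment> \<open>Ultrametric principle: every point of a ball is a centre of it, so a ball that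
    meets \<open>A\<close> lies in \<open>A\<close>.\<close>
  have sub: "B x \<subseteq> A" if "x \<in> T" "z \<in> A" "z \<in> B x" for x z
  proof
    fix w
    assume w: "w \<in> B x"
    define t where "t p = (w p - z p) / \<delta>" for p
    have le: "absv (w p - z p) \<le> absv \<delta>" if "p \<in> I" for p
      using absv_diff_le_trans[of "x p" "w p" "absv \<delta>" "z p"] that w \<open>z \<in> B x\<close>
      by (metis (mono_tags, lifting) B_def absv_minus mem_Collect_eq minus_diff_eq)
    have "t \<in> T"
    proof (rule free_modI)
      show "absv (t p) \<le> 1" if "p \<in> I" for p
        using le[OF that] assms(2) by (simp add: t_def absv_divide)
      show "t p = 0" if "p \<notin> I" for p
        using that w \<open>z \<in> A\<close> assms(1) free_mod_outside[of w I p] free_mod_outside[of z I p]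
        by (auto simp: t_def B_def)
    qed
    then have "z + (\<lambda>p. \<delta> * t p) \<in> A"
      using A that by blast
    moreover have "z + (\<lambda>p. \<delta> * t p) = w"
      using assms(2) by (auto simp: t_def)
    ultimately show "w \<in> A"
      by simp
  qed
  define Y where "Y = {y \<in> box I R. B y \<subseteq> A}"
  have "finite Y"
    unfolding Y_def using R by (intro finite_subset[OF _ finite_box[OF finite_Tidx, of _ _ _ R]]) (auto simp: reps_def)
  have "A = (\<Union>y\<in>Y. B y)"
  proof
    show "A \<subseteq> (\<Union>y\<in>Y. B y)"
    proof
      fix z
      assume z: "z \<in> A"
      then have "z \<in> T"
        using assms(1) by blast
      obtain y u where y: "y \<in> box I R" and u: "u \<in> T" "z = y + (\<lambda>p. \<delta> * u p)"
        by (rule triangular_decompose[OF tri finite_Tidx R \<open>z \<in> T\<close>])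
      have "absv (z p - y p) \<le> absv \<delta>" for p
        using free_mod_le[OF u(1), of p] by (simp add: u(2) absv_mult mult_left_le)
      then have "z \<in> B y"
        using \<open>z \<in> T\<close> by (simp add: B_def)
      moreover have "y \<in> T"
        using y by (simp add: box_def)
      ultimately show "z \<in> (\<Union>y\<in>Y. B y)"
        using sub[of y z] y z by (auto simp: Y_def)
    qed
  qed (auto simp: Y_def)
  also have "\<dots> \<in> sets M"
    using \<open>finite Y\<close> B by (intro sets.finite_UN) (auto simp: Y_def box_def)
  finally show ?thesis .
qed

context
  fixes \<rho> D L
  assumes tri: "triangular I \<rho> D L"
begin

lemma sets_translate_image:
  assumes "a \<in> T"
  shows "(\<lambda>y. y + a) ` L ` T \<in> sets M"
proof -
  have H: "submod I (L ` T)"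
    using tri by (rule submod_image)
  obtain \<delta> where \<delta>: "\<delta> \<noteq> 0" "absv \<delta> \<le> 1" "\<And>t. t \<in> T \<Longrightarrow> (\<lambda>i. \<delta> * t i) \<in> L ` T"
    using submod_contains_scaled_free_mod[OF finite_Tidx H triangular_index(1)[OF tri finite_Tidx]] by metis
  show ?thesis
  proof (rule sets_M_open[OF _ \<delta>(1,2)])
    show "(\<lambda>y. y + a) ` L ` T \<subseteq> T"
      using triangular_mem[OF tri] assms by (auto intro: free_mod_add)
    fix x t
    assume x: "x \<in> (\<lambda>y. y + a) ` L ` T" and t: "t \<in> T"
    from x obtain y where y: "y \<in> L ` T" "x = y + a"
      by blast
    have "x + (\<lambda>i. \<delta> * t i) = (y + (\<lambda>i. \<delta> * t i)) + a"
      using y(2) by (simp add: algebra_simps)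
    then show "x + (\<lambda>i. \<delta> * t i) \<in> (\<lambda>y. y + a) ` L ` T"
      using submod_add[OF H y(1) \<delta>(3)[OF t]] by (rule image_eqI)
  qed
qed

lemma sets_image: "L ` T \<in> sets M"
  using sets_translate_image[OF free_mod_0] by simp

lemma measure_translate_image: "a \<in> T \<Longrightarrow> measure M ((\<lambda>y. y + a) ` L ` T) = measure M (L ` T)"
  unfolding measure_def by (simp add: emeasure_translate sets_image)

text \<open>The set \<open>Y\<close> is left general for two uses: a full box tiles \<open>T\<close>
  and yields the measure of the image, while the images of the unit representatives tile a
  fibre.\<close>

lemma measure_disjoint_translates:
  assumes "finite Y" "Y \<subseteq> T"
    and disj: "\<And>y y' u u'. y \<in> Y \<Longrightarrow> y' \<in> Y \<Longrightarrow> u \<in> T \<Longrightarrow> u' \<in> T \<Longrightarrow> y + L u = y' + L u' \<Longrightarrow> y = y'"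
  shows "(\<Union>y\<in>Y. (\<lambda>v. v + y) ` L ` T) \<in> sets M"
    "measure M (\<Union>y\<in>Y. (\<lambda>v. v + y) ` L ` T) = real (card Y) * measure M (L ` T)"
proof -
  show "(\<Union>y\<in>Y. (\<lambda>v. v + y) ` L ` T) \<in> sets M"
    using assms by (intro sets.finite_UN sets_translate_image) auto
  have "disjoint_family_on (\<lambda>y. (\<lambda>v. v + y) ` L ` T) Y"
    unfolding disjoint_family_on_def
  proof (intro ballI impI)
    fix y y'
    assume y: "y \<in> Y" "y' \<in> Y" "y \<noteq> y'"
    have False if "u \<in> T" "u' \<in> T" "L u + y = L u' + y'" for u u'
      using disj[OF y(1,2) that(1,2)] that(3) y(3) by (metis add.commute)
    then show "(\<lambda>v. v + y) ` L ` T \<inter> (\<lambda>v. v + y') ` L ` T = {}"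
      by blast
  qed
  then have "measure M (\<Union>y\<in>Y. (\<lambda>v. v + y) ` L ` T) = (\<Sum>y\<in>Y. measure M ((\<lambda>v. v + y) ` L ` T))"
    using assms by (intro M.finite_measure_finite_Union) (auto intro!: sets_translate_image)
  also have "\<dots> = (\<Sum>y\<in>Y. measure M (L ` T))"
    using assms(2) by (intro sum.cong measure_translate_image refl) auto
  finally show "measure M (\<Union>y\<in>Y. (\<lambda>v. v + y) ` L ` T) = real (card Y) * measure M (L ` T)"
    by simp
qed

text \<open>Total mass 1 is shared equally among the translates by a box, whose number is the
  inverse of the product of the |D p|.\<close>

lemma measure_image: "measure M (L ` T) = (\<Prod>p\<in>I. absv (D p))"
proof -
  obtain R where R: "\<And>p. p \<in> I \<Longrightarrow> reps (D p) (R p)" "\<And>p. p \<in> I \<Longrightarrow> real (card (R p)) * absv (D p) = 1"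
    using triangular_reps[OF tri] by metis
  note card = triangular_card_box[OF tri finite_Tidx R]
  have "T = (\<Union>y\<in>box I R. (\<lambda>v. v + y) ` L ` T)"
  proof
    show "T \<subseteq> (\<Union>y\<in>box I R. (\<lambda>v. v + y) ` L ` T)"
    proof
      fix z
      assume z: "z \<in> T"
      obtain y u where yu: "y \<in> box I R" "u \<in> T" "z = y + L u"
        by (rule triangular_decompose[OF tri finite_Tidx R(1) z])
      then show "z \<in> (\<Union>y\<in>box I R. (\<lambda>v. v + y) ` L ` T)"
        by (intro UN_I[of y] image_eqI[of _ _ "L u"] imageI) (auto simp: add.commute)
    qed
    show "(\<Union>y\<in>box I R. (\<lambda>v. v + y) ` L ` T) \<subseteq> T"
      using triangular_mem[OF tri] by (auto simp: box_def intro: free_mod_add)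
  qed
  then have "measure M T = real (card (box I R)) * measure M (L ` T)"
    using measure_disjoint_translates(2)[of "box I R"] card(1) triangular_unique[OF tri R(1)]
    by (auto simp: box_def)
  moreover have "measure M T = 1"
    by (simp add: measure_def emeasure_T)
  ultimately show ?thesis
    using card(2) by (metis mult.commute mult_cancel_left mult_zero_left zero_neq_one)
qed

end

end

section \<open>Row spans of block triangular matrices\<close>

lemma mulA_add_left: "mulA d c (u + v) w = mulA d c u w + mulA d c v w"
  and mulA_add_right: "mulA d c w (u + v) = mulA d c w u + mulA d c w v"
  and mulA_scale_left: "mulA d c (\<lambda>i. a * u i) w = (\<lambda>i. a * mulA d c u w i)"
  and mulA_scale_right: "mulA d c w (\<lambda>i. a * u i) = (\<lambda>i. a * mulA d c w u i)"
  by (auto simp: mulA_def fun_eq_iff algebra_simps sum.distrib sum_distrib_left)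

lemma mulA_0_left: "mulA d c 0 w = 0"
  and mulA_0_right: "mulA d c w 0 = 0"
  by (auto simp: mulA_def fun_eq_iff)

lemma mulA_sum_left: "mulA d c (\<Sum>j\<in>S. f j) w = (\<Sum>j\<in>S. mulA d c (f j) w)"
  proof (induction S rule: infinite_finite_induct)
  case (infinite S)
  then show ?case
    by (simp only: sum.infinite mulA_0_left not_False_eq_True)
next
  case empty
  show ?case
    unfolding sum.empty by (rule mulA_0_left)
next
  case (insert j S)
  then show ?case
    by (simp only: sum.insert mulA_add_left not_False_eq_True)
qed

lemma mulA_sum_right: "mulA d c w (\<Sum>j\<in>S. f j) = (\<Sum>j\<in>S. mulA d c w (f j))"
  proof (induction S rule: infinite_finite_induct)
  case (infinite S)
  then show ?case
    by (simp only: sum.infinite mulA_0_right not_False_eq_True)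
next
  case empty
  show ?case
    unfolding sum.empty by (rule mulA_0_right)
next
  case (insert j S)
  then show ?case
    by (simp only: sum.insert mulA_add_right not_False_eq_True)
qed

section \<open>Matrix products in terms of entries\<close>

definition rowcomb :: "nat \<Rightarrow> (nat \<times> nat \<Rightarrow> 'k::field) \<Rightarrow> (nat \<Rightarrow> 'k) \<Rightarrow> nat \<Rightarrow> 'k" where
  "rowcomb d x v = (\<lambda>b. \<Sum>k<d. v k * x (k, b))"

text \<open>The matrix product u m, with \<open>m\<close> as the first argument so that
  \<open>rowmul d m\<close> is right multiplication by \<open>m\<close>. The vector-matrix product v
  x is \<open>rowcomb d x v\<close> in the same style.\<close>

definition rowmul :: "nat \<Rightarrow> (nat \<times> nat \<Rightarrow> 'k::field) \<Rightarrow> (nat \<times> nat \<Rightarrow> 'k) \<Rightarrow> nat \<times> nat \<Rightarrow> 'k" where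
  "rowmul d m u = (\<lambda>(a, b). \<Sum>k<d. u (a, k) * m (k, b))"

lemma rowcomb_eq_sum: "rowcomb d x v = (\<Sum>k<d. (\<lambda>b. v k * x (k, b)))"
proof
  show "rowcomb d x v b = (\<Sum>k<d. (\<lambda>b. v k * x (k, b))) b" for b
    unfolding rowcomb_def by (induction d) simp_all
qed

lemma rowcomb_rowmul: "rowcomb d (rowmul d m u) v = rowcomb d m (rowcomb d u v)"
proof
  fix b
  have "rowcomb d (rowmul d m u) v b = (\<Sum>k<d. \<Sum>l<d. v k * (u (k, l) * m (l, b)))"
    by (simp add: rowcomb_def rowmul_def sum_distrib_left)
  also have "\<dots> = (\<Sum>l<d. \<Sum>k<d. v k * (u (k, l) * m (l, b)))"
    by (rule sum.swap)
  also have "\<dots> = rowcomb d m (rowcomb d u v) b"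
    by (simp add: rowcomb_def sum_distrib_right mult.assoc)
  finally show "rowcomb d (rowmul d m u) v b = rowcomb d m (rowcomb d u v) b" .
qed

lemma rowcomb_unit: "a < d \<Longrightarrow> rowcomb d x (\<lambda>k. if k = a then 1 else 0) = (\<lambda>b. x (a, b))"
  by (simp add: rowcomb_def if_distrib[of "\<lambda>t. t * _"] sum.delta cong: if_cong)

lemma mulA_rowcomb:
  "mulA d c (rowcomb d x u) (rowcomb d x v)
     = (\<Sum>i<d. \<Sum>j<d. (\<lambda>k. u i * (v j * mulA d c (\<lambda>b. x (i, b)) (\<lambda>b. x (j, b)) k)))"
  unfolding rowcomb_eq_sum mulA_sum_left
  unfolding mulA_sum_right mulA_scale_left mulA_scale_right
  by (simp add: fun_eq_iff sum_fun_app sum_distrib_left)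

lemma sum_eq_single_term:
  fixes b d :: nat
  assumes "b < d" "\<And>k. k < d \<Longrightarrow> k \<noteq> b \<Longrightarrow> f k = (0 :: 'a::comm_monoid_add)"
  shows "(\<Sum>k<d. f k) = f b"
proof -
  have "(\<Sum>k<d. f k) = (\<Sum>k\<in>{b}. f k)"
    using assms by (intro sum.mono_neutral_right) auto
  then show ?thesis
    by simp
qed

lemma sum_mult_adj_mat:
  assumes "A \<in> carrier_mat d d" "i < d" "j < d"
  shows "(\<Sum>k<d. A $$ (i, k) * adj_mat A $$ (k, j)) = (if i = j then Determinant.det A else 0)"
    "(\<Sum>k<d. adj_mat A $$ (i, k) * A $$ (k, j)) = (if i = j then Determinant.det A else 0)"
proof -
  note adj = adj_mat[OF assms(1)]
  have "(A * adj_mat A) $$ (i, j) = (Determinant.det A \<cdot>\<^sub>m 1\<^sub>m d) $$ (i, j)"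
    by (simp only: adj)
  then show "(\<Sum>k<d. A $$ (i, k) * adj_mat A $$ (k, j)) = (if i = j then Determinant.det A else 0)"
    using assms adj(1) by (auto simp: scalar_prod_def lessThan_atLeast0)
  have "(adj_mat A * A) $$ (i, j) = (Determinant.det A \<cdot>\<^sub>m 1\<^sub>m d) $$ (i, j)"
    by (simp only: adj)
  then show "(\<Sum>k<d. adj_mat A $$ (i, k) * A $$ (k, j)) = (if i = j then Determinant.det A else 0)"
    using assms adj(1) by (auto simp: scalar_prod_def lessThan_atLeast0)
qed

context block_structure
begin

section \<open>Combinatorics of the block shape\<close>

lemma \<beta>_mono: "i \<le> j \<Longrightarrow> j \<le> r \<Longrightarrow> \<beta> i \<le> \<beta> j"
proof (induction rule: dec_induct)
  case (step n)
  then show ?case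
    using \<beta>_less[of n] by simp
qed simp

lemma \<beta>_le_d: "i \<le> r \<Longrightarrow> \<beta> i \<le> d"
  using \<beta>_mono[of i r] \<beta>_r by simp

definition in_block :: "nat \<Rightarrow> nat \<Rightarrow> bool" where
  "in_block i k \<longleftrightarrow> \<beta> i \<le> k \<and> k < \<beta> (Suc i)"

lemma in_block_exists:
  assumes "k < d"
  obtains i where "i < r" "in_block i k"
proof -
  have "\<exists>i<n. in_block i k" if "k < \<beta> n" for n
    using that
  proof (induction n)
    case (Suc n)
    then show ?case
      by (cases "k < \<beta> n") (auto simp: in_block_def less_Suc_eq)
  qed (simp add: \<beta>_0)
  then show ?thesis
    using assms \<beta>_r that by blast
qed

lemma in_block_unique: "i < r \<Longrightarrow> j < r \<Longrightarrow> in_block i k \<Longrightarrow> in_block j k \<Longrightarrow> i = j"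
  using \<beta>_mono[of "Suc i" j] \<beta>_mono[of "Suc j" i]
  by (fastforce simp: in_block_def intro: linorder_cases[of i j])

lemma in_block_less_d: "i < r \<Longrightarrow> in_block i k \<Longrightarrow> k < d"
  using \<beta>_le_d[of "Suc i"] by (simp add: in_block_def)

lemma mem_I_iff: "(a, b) \<in> I \<longleftrightarrow> a \<le> b \<and> (\<exists>i<r. in_block i a \<and> in_block i b)"
proof
  assume "(a, b) \<in> I"
  then obtain i where "a \<le> b" "i < r" "\<beta> i \<le> a" "b < \<beta> (Suc i)"
    by (auto simp: Tidx_def)
  then show "a \<le> b \<and> (\<exists>i<r. in_block i a \<and> in_block i b)"
    by (auto simp: in_block_def intro!: exI[of _ i])
next
  assume "a \<le> b \<and> (\<exists>i<r. in_block i a \<and> in_block i b)"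
  then obtain i where i: "a \<le> b" "i < r" "in_block i a" "in_block i b"
    by blast
  with in_block_less_d[OF i(2,4)] show "(a, b) \<in> I"
    by (auto simp: Tidx_def in_block_def)
qed

lemma mem_I_iff_block: "i < r \<Longrightarrow> in_block i a \<Longrightarrow> (a, b) \<in> I \<longleftrightarrow> a \<le> b \<and> in_block i b"
  unfolding mem_I_iff using in_block_unique by blast

lemma mem_I_less: "(a, b) \<in> I \<Longrightarrow> a \<le> b" "(a, b) \<in> I \<Longrightarrow> b < d"
  by (auto simp: Tidx_def)

lemma mem_I_D: "(a, b) \<in> I \<Longrightarrow> a \<le> b \<and> b < d"
  by (simp add: mem_I_less)

lemma mem_I_diag: "k < d \<Longrightarrow> (k, k) \<in> I"
  using in_block_exists[of k] unfolding mem_I_iff by blast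

text \<open>The positions form a partial order on the indices, so \<open>T\<close> is an incidence
  algebra. Transitivity is the reason why it is closed under matrix products.\<close>

lemma mem_I_trans: "(a, k) \<in> I \<Longrightarrow> (k, b) \<in> I \<Longrightarrow> (a, b) \<in> I"
  unfolding mem_I_iff using in_block_unique by (metis order_trans)

section \<open>Nondegenerate matrices and their row spans\<close>

definition nondeg :: "(nat \<times> nat \<Rightarrow> 'k) set" where
  "nondeg = {x \<in> T. \<forall>k<d. x (k, k) \<noteq> 0}"

definition rowspan :: "(nat \<times> nat \<Rightarrow> 'k) \<Rightarrow> (nat \<Rightarrow> 'k) set" where
  "rowspan x = rowcomb d x ` free_mod {..<d}"

lemma nondegD: "x \<in> nondeg \<Longrightarrow> x \<in> T" "x \<in> nondeg \<Longrightarrow> k < d \<Longrightarrow> x (k, k) \<noteq> 0"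
  by (auto simp: nondeg_def)

lemma T_outside: "x \<in> T \<Longrightarrow> (a, b) \<notin> I \<Longrightarrow> x (a, b) = 0"
  by (rule free_mod_outside)

lemma T_le: "x \<in> T \<Longrightarrow> absv (x p) \<le> 1"
  by (rule free_mod_le)

lemma rowcomb_mem:
  assumes "x \<in> T" "v \<in> free_mod {..<d}"
  shows "rowcomb d x v \<in> free_mod {..<d}"
proof (rule free_modI)
  show "absv (rowcomb d x v b) \<le> 1" for b
    unfolding rowcomb_def using assms by (intro absv_sum_le absv_mult_le_1 free_mod_le) auto
  show "rowcomb d x v b = 0" if "b \<notin> {..<d}" for b
  proof -
    have "(k, b) \<notin> I" for k
      using that mem_I_D[of k b] by auto
    then show ?thesis
      by (simp add: rowcomb_def T_outside[OF assms(1)])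
  qed
qed

lemma triangular_rowcomb:
  assumes "x \<in> nondeg"
  shows "triangular {..<d} id (\<lambda>k. x (k, k)) (rowcomb d x)"
  unfolding triangular_def
proof (intro conjI ballI allI impI)
  fix k
  assume "k \<in> {..<d}"
  then show "x (k, k) \<noteq> 0" "absv (x (k, k)) \<le> 1"
    using nondegD[OF assms] T_le by auto
next
  fix u :: "nat \<Rightarrow> 'k" and b
  assume b: "b \<in> {..<d}" and low: "\<forall>k\<in>{..<d}. id k < id b \<longrightarrow> u k = 0"
  have "rowcomb d x u b = u b * x (b, b)"
    unfolding rowcomb_def
  proof (rule sum_eq_single_term)
    fix k
    assume "k < d" "k \<noteq> b"
    show "u k * x (k, b) = 0"
    proof (cases "k < b")
      case True
      then show ?thesis
        using low \<open>k < d\<close> by auto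
    next
      case False
      then have "(k, b) \<notin> I"
        using \<open>k \<noteq> b\<close> mem_I_D[of k b] by auto
      then show ?thesis
        using nondegD(1)[OF assms] by (simp add: T_outside)
    qed
  qed (use b in auto)
  then show "rowcomb d x u b = x (b, b) * u b"
    by simp
qed (auto simp: rowcomb_mem nondegD[OF assms], auto simp: rowcomb_def fun_eq_iff algebra_simps sum.distrib sum_distrib_left)

lemma rowmul_mem:
  assumes "m \<in> T" "u \<in> T"
  shows "rowmul d m u \<in> T"
proof (rule free_modI)
  fix p
  show "absv (rowmul d m u p) \<le> 1"
    unfolding rowmul_def case_prod_beta using assms by (intro absv_sum_le absv_mult_le_1 T_le) auto
  assume p: "p \<notin> I"
  have "u (fst p, k) * m (k, snd p) = 0" for k
    using p mem_I_trans[of "fst p" k "snd p"] T_outside[OF assms(1), of k "snd p"] T_outside[OF assms(2), of "fst p" k]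
    by auto
  then show "rowmul d m u p = 0"
    unfolding rowmul_def case_prod_beta by (intro sum.neutral ballI)
qed

text \<open>The entry of u m at \<open>(a, b)\<close> involves only entries of \<open>u\<close> in
  columns up to \<open>b\<close>, so the column serves as rank. The diagonal entry depends on the
  column alone, hence is repeated once for each position of that column.\<close>

lemma triangular_rowmul:
  assumes "m \<in> nondeg"
  shows "triangular I snd (\<lambda>p. m (snd p, snd p)) (rowmul d m)"
  unfolding triangular_def
proof (intro conjI ballI allI impI)
  fix p
  assume "p \<in> I"
  then show "m (snd p, snd p) \<noteq> 0" "absv (m (snd p, snd p)) \<le> 1"
    using nondegD[OF assms] T_le mem_I_less(2)[of "fst p" "snd p"] by auto
next
  fix u p
  assume u: "u \<in> T" and p: "p \<in> I" and low: "\<forall>p'\<in>I. snd p' < snd p \<longrightarrow> u p' = 0"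
  obtain a b where ab: "p = (a, b)"
    by (cases p)
  have "rowmul d m u p = u (a, b) * m (b, b)"
    unfolding rowmul_def ab prod.case
  proof (rule sum_eq_single_term)
    show "b < d"
      using p ab mem_I_less by blast
    fix k
    assume "k < d" "k \<noteq> b"
    show "u (a, k) * m (k, b) = 0"
    proof (cases "k < b")
      case True
      then have "u (a, k) = 0"
        using low ab T_outside[OF u, of a k] by fastforce
      then show ?thesis
        by simp
    next
      case False
      then have "(k, b) \<notin> I"
        using \<open>k \<noteq> b\<close> mem_I_D[of k b] by auto
      then show ?thesis
        using nondegD(1)[OF assms] by (simp add: T_outside)
    qed
  qed
  then show "rowmul d m u p = m (snd p, snd p) * u p"
    by (simp add: ab)
qed (auto simp: rowmul_mem nondegD[OF assms], auto simp: rowmul_def fun_eq_iff algebra_simps sum.distrib sum_distrib_left)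

lemma submod_rowspan: "x \<in> nondeg \<Longrightarrow> submod {..<d} (rowspan x)"
  unfolding rowspan_def by (rule submod_image[OF triangular_rowcomb])

lemma row_mem_rowspan: "a < d \<Longrightarrow> (\<lambda>b. x (a, b)) \<in> rowspan x"
  unfolding rowspan_def
  by (rule image_eqI[of _ _ "\<lambda>k. if k = a then 1 else 0"]) (auto simp: free_mod_def rowcomb_unit)

lemma rowmul_diag:
  assumes "m \<in> T" "u \<in> T" "k < d"
  shows "rowmul d m u (k, k) = u (k, k) * m (k, k)"
  unfolding rowmul_def prod.case
proof (rule sum_eq_single_term[OF assms(3)])
  fix l
  assume "l < d" "l \<noteq> k"
  then have "(k, l) \<notin> I \<or> (l, k) \<notin> I"
    using mem_I_D[of k l] mem_I_D[of l k] by auto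
  then show "u (k, l) * m (l, k) = 0"
    using T_outside assms by auto
qed

lemma rowspan_rowmul_subset:
  assumes "u \<in> T"
  shows "rowspan (rowmul d m u) \<subseteq> rowspan m"
  unfolding rowspan_def rowcomb_rowmul using rowcomb_mem[OF assms] by blast

text \<open>The coordinates of the rows of \<open>x\<close> with respect to the rows of
  \<open>m\<close> form the quotient matrix \<open>u\<close>. The point is that \<open>u\<close>
  inherits the block triangular shape.\<close>

lemma rowmul_exists:
  assumes m: "m \<in> nondeg" and x: "x \<in> T" and rows: "rowspan x \<subseteq> rowspan m"
  obtains u where "u \<in> T" "x = rowmul d m u"
proof -
  have "\<forall>a<d. \<exists>v\<in>free_mod {..<d}. (\<lambda>b. x (a, b)) = rowcomb d m v"
    using rows row_mem_rowspan unfolding rowspan_def by blast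
  then obtain f where f: "\<And>a. a < d \<Longrightarrow> f a \<in> free_mod {..<d}"
    "\<And>a. a < d \<Longrightarrow> (\<lambda>b. x (a, b)) = rowcomb d m (f a)"
    by metis
  define u where "u = (\<lambda>(a, b). if a < d then f a b else 0)"
  have x_eq: "x (a, b) = (\<Sum>k<d. u (a, k) * m (k, b))" for a b
  proof (cases "a < d")
    case True
    then show ?thesis
      using fun_cong[OF f(2)[OF True], of b] by (simp add: u_def rowcomb_def)
  next
    case False
    then have "(a, b) \<notin> I"
      using mem_I_D[of a b] by auto
    then show ?thesis
      using False T_outside[OF x] by (simp add: u_def)
  qed
  \<comment> \<open>Induction over the columns. In the expansion of \<open>x (a, b) = 0\<close> a
    term with \<open>k \<noteq> b\<close> and \<open>m (k, b) \<noteq> 0\<close> has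
    \<open>k < b\<close> and, by transitivity, \<open>(a, k) \<notin> I\<close>, so it vanishes by
    induction; \<open>u (a, b) * m (b, b) = 0\<close> remains.\<close>
  have out: "u (a, b) = 0" if "(a, b) \<notin> I" for a b
    using that
  proof (induction b rule: less_induct)
    case (less b)
    show ?case
    proof (cases "a < d \<and> b < d")
      case True
      have "x (a, b) = u (a, b) * m (b, b)"
        unfolding x_eq
      proof (rule sum_eq_single_term)
        fix k
        assume k: "k < d" "k \<noteq> b"
        show "u (a, k) * m (k, b) = 0"
        proof (cases "(k, b) \<in> I")
          case True
          then have "k < b" "(a, k) \<notin> I"
            using k less.prems mem_I_D[of k b] mem_I_trans[of a k b] by auto
          then show ?thesis
            using less.IH by simp
        next
          case False
          then show ?thesis
            using nondegD(1)[OF m] by (simp add: T_outside)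
        qed
      qed (use True in simp)
      then show ?thesis
        using T_outside[OF x less.prems] nondegD(2)[OF m] True by simp
    next
      case False
      then show ?thesis
        using f(1)[of a] by (auto simp: u_def free_mod_def)
    qed
  qed
  have "u \<in> T"
  proof (rule free_modI)
    show "absv (u p) \<le> 1" for p
      using f(1) free_mod_le[of "f (fst p)" "{..<d}" "snd p"] by (cases p) (auto simp: u_def)
    show "u p = 0" if "p \<notin> I" for p
      using out that by (cases p) auto
  qed
  moreover have "x = rowmul d m u"
    by (auto simp: rowmul_def x_eq)
  ultimately show ?thesis
    by (rule that)
qed

text \<open>The unit group of the ring of block triangular matrices: the determinant is the product
  of the diagonal entries.\<close>

definition unit_diag :: "(nat \<times> nat \<Rightarrow> 'k) set" where
  "unit_diag = {u \<in> T. \<forall>k<d. absv (u (k, k)) = 1}"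

lemma unit_diag_nondeg: "unit_diag \<subseteq> nondeg"
  by (auto simp: unit_diag_def nondeg_def simp flip: absv_eq_0)

text \<open>Equal spans give x = u m and m = u' x; comparing diagonals, \<open>u (k, k)\<close> and
  \<open>u' (k, k)\<close> are mutually inverse and both integral, so both are units. Conversely, a
  \<open>u\<close> with unit diagonal acts surjectively on row vectors, so u m and \<open>m\<close>
  span the same module.\<close>

lemma rowspan_eq_iff:
  assumes m: "m \<in> nondeg"
  shows "{x \<in> nondeg. rowspan x = rowspan m} = rowmul d m ` unit_diag"
proof (intro equalityI subsetI)
  fix x
  assume "x \<in> {x \<in> nondeg. rowspan x = rowspan m}"
  then have x: "x \<in> nondeg" and eq: "rowspan x = rowspan m"
    by auto
  obtain u where u: "u \<in> T" "x = rowmul d m u"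
    by (rule rowmul_exists[OF m nondegD(1)[OF x]]) (simp add: eq)
  obtain u' where u': "u' \<in> T" "m = rowmul d x u'"
    by (rule rowmul_exists[OF x nondegD(1)[OF m]]) (simp add: eq)
  have "absv (u (k, k)) = 1" if k: "k < d" for k
  proof -
    have "x (k, k) = u (k, k) * m (k, k)" "m (k, k) = u' (k, k) * x (k, k)"
      by (rule rowmul_diag[OF nondegD(1)[OF m] u(1) k, folded u(2)],
          rule rowmul_diag[OF nondegD(1)[OF x] u'(1) k, folded u'(2)])
    then have "u (k, k) * u' (k, k) = 1"
      using nondegD(2)[OF x k] by auto
    then have "absv (u (k, k)) * absv (u' (k, k)) = 1"
      by (metis absv_1 absv_mult)
    then show ?thesis
      using T_le[OF u(1), of "(k, k)"] T_le[OF u'(1), of "(k, k)"]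
        mult_left_le[of "absv (u' (k, k))" "absv (u (k, k))"] by simp
  qed
  then show "x \<in> rowmul d m ` unit_diag"
    using u by (auto simp: unit_diag_def)
next
  fix x
  assume "x \<in> rowmul d m ` unit_diag"
  then obtain u where u: "u \<in> unit_diag" "x = rowmul d m u"
    by blast
  then have uT: "u \<in> T" and ud: "\<And>k. k < d \<Longrightarrow> absv (u (k, k)) = 1"
    by (auto simp: unit_diag_def)
  have un: "u \<in> nondeg"
    using u unit_diag_nondeg by blast
  have "x \<in> nondeg"
    using rowmul_mem[OF nondegD(1)[OF m] uT] rowmul_diag[OF nondegD(1)[OF m] uT] nondegD(2)[OF m] nondegD(2)[OF un]
    by (auto simp: nondeg_def u(2))
  moreover have "rowspan m \<subseteq> rowspan x"
  proof
    fix w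
    assume "w \<in> rowspan m"
    then obtain v where v: "v \<in> free_mod {..<d}" "w = rowcomb d m v"
      by (auto simp: rowspan_def)
    obtain v' where "v' \<in> free_mod {..<d}" "rowcomb d u v' = v"
      using triangular_surj[OF triangular_rowcomb[OF un] _ _ v(1)] ud by auto
    then have "rowcomb d x v' = w"
      by (simp add: u(2) v(2) rowcomb_rowmul)
    then show "w \<in> rowspan x"
      using \<open>v' \<in> free_mod {..<d}\<close> by (auto simp: rowspan_def)
  qed
  ultimately show "x \<in> {x \<in> nondeg. rowspan x = rowspan m}"
    using rowspan_rowmul_subset[OF uT] u(2) by auto
qed

lemma card_cosets_rowspan:
  assumes "x \<in> nondeg"
  shows "finite (cosets absv d (rowspan x))"
    "real (card (cosets absv d (rowspan x))) * (\<Prod>k<d. absv (x (k, k))) = 1"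
  using triangular_index[OF triangular_rowcomb[OF assms]]
  by (simp_all add: cosets_def rowspan_def Acar_eq_free_mod)

section \<open>Homogeneous submodules and Hermite normal form\<close>

definition block_proj :: "nat \<Rightarrow> (nat \<Rightarrow> 'k) \<Rightarrow> nat \<Rightarrow> 'k" where
  "block_proj i v k = (if in_block i k then v k else 0)"

lemma Ablock_iff: "v \<in> Ablock absv d \<beta> i \<longleftrightarrow> v \<in> free_mod {..<d} \<and> (\<forall>k. v k \<noteq> 0 \<longrightarrow> in_block i k)"
  by (simp add: Ablock_def Acar_eq_free_mod in_block_def)

lemma sum_block_proj:
  assumes "v \<in> free_mod {..<d}"
  shows "(\<Sum>i<r. block_proj i v) = v"
proof
  fix k
  show "(\<Sum>i<r. block_proj i v) k = v k"
  proof (cases "k < d")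
    case True
    then obtain i where i: "i < r" "in_block i k"
      by (rule in_block_exists)
    have "(\<Sum>j<r. block_proj j v k) = (\<Sum>j\<in>{i}. block_proj j v k)"
      using i in_block_unique by (intro sum.mono_neutral_right) (auto simp: block_proj_def)
    then show ?thesis
      using i by (simp add: sum_fun_app block_proj_def)
  next
    case False
    then have "v k = 0"
      using assms by (simp add: free_mod_outside)
    then show ?thesis
      by (simp add: sum_fun_app block_proj_def cong: if_cong)
  qed
qed

text \<open>Replaces the existential decomposition by closure under the block projections. The
  components can be taken to be the intersections of \<open>U\<close> with the blocks.\<close>

lemma homogeneous_iff:
  assumes U: "submod {..<d} U"
  shows "homogeneous absv d \<beta> r U \<longleftrightarrow> (\<forall>u\<in>U. \<forall>i<r. block_proj i u \<in> U)"
proof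
  assume "homogeneous absv d \<beta> r U"
  then obtain Us where Us: "\<And>i. i < r \<Longrightarrow> is_submodule absv d (Us i)" "\<And>i. i < r \<Longrightarrow> Us i \<subseteq> Ablock absv d \<beta> i"
    and U_eq: "U = {(\<Sum>i<r. w i) | w. \<forall>i<r. w i \<in> Us i}"
    unfolding homogeneous_def by blast
  show "\<forall>u\<in>U. \<forall>i<r. block_proj i u \<in> U"
  proof (intro ballI allI impI)
    fix u i
    assume "u \<in> U" and i: "i < r"
    then obtain w where w: "u = (\<Sum>i<r. w i)" "\<And>i. i < r \<Longrightarrow> w i \<in> Us i"
      unfolding U_eq by blast
    \<comment> \<open>The family that keeps only the \<open>i\<close>-th component exhibits the
      projection as a sum of the required form.\<close>
    define w' where "w' j = (if j = i then w i else 0)" for j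
    have "block_proj i u k = w i k" for k
    proof -
      have "w j k = 0" if "j < r" "in_block i k" "j \<noteq> i" for j
      proof -
        have "w j \<in> Ablock absv d \<beta> j"
          using Us(2)[OF that(1)] w(2)[OF that(1)] by blast
        then show ?thesis
          using in_block_unique[OF i that(1,2)] that(3) by (auto simp: Ablock_iff)
      qed
      then have "u k = w i k" if "in_block i k"
        using that i unfolding w(1) sum_fun_app
        by (subst sum.mono_neutral_right[of _ "{i}"]) auto
      moreover have "w i k = 0" if "\<not> in_block i k"
      proof -
        have "w i \<in> Ablock absv d \<beta> i"
          using Us(2)[OF i] w(2)[OF i] by blast
        then show ?thesis
          using that by (auto simp: Ablock_iff)
      qed
      ultimately show ?thesis
        by (simp add: block_proj_def)
    qed
    moreover have "(\<Sum>j<r. w' j) = w i"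
      using i unfolding w'_def by (simp add: sum.delta)
    ultimately have "block_proj i u = (\<Sum>j<r. w' j)"
      by auto
    moreover have "\<forall>j<r. w' j \<in> Us j"
      using w(2) Us(1) by (auto simp: w'_def is_submodule_def)
    ultimately show "block_proj i u \<in> U"
      unfolding U_eq by blast
  qed
next
  assume proj: "\<forall>u\<in>U. \<forall>i<r. block_proj i u \<in> U"
  let ?Us = "\<lambda>i. U \<inter> Ablock absv d \<beta> i"
  have "is_submodule absv d (?Us i)" for i
    unfolding is_submodule_iff_submod submod_def
  proof (intro conjI ballI)
    show "?Us i \<subseteq> free_mod {..<d}" "0 \<in> ?Us i"
      using submod_0[OF U] by (auto simp: Ablock_iff)
    show "u + v \<in> ?Us i" if "u \<in> ?Us i" "v \<in> ?Us i" for u v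
    proof -
      have "u \<in> U" "v \<in> U" and uv: "\<forall>k. u k \<noteq> 0 \<longrightarrow> in_block i k" "\<forall>k. v k \<noteq> 0 \<longrightarrow> in_block i k"
        using that by (simp_all add: Ablock_iff)
      then have "u + v \<in> U"
        using submod_add[OF U] by blast
      moreover have "\<forall>k. (u + v) k \<noteq> 0 \<longrightarrow> in_block i k"
        using uv by (metis add_0 plus_fun_apply)
      ultimately show ?thesis
        using submod_sub[OF U] by (simp add: Ablock_iff)
    qed
    show "(\<lambda>k. a * u k) \<in> ?Us i" if "a \<in> valring absv" "u \<in> ?Us i" for a u
    proof -
      have "(\<lambda>k. a * u k) \<in> U"
        using that submod_scale[OF U] by simp
      then show ?thesis
        using that submod_sub[OF U] by (simp add: Ablock_iff)
    qed
  qed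
  moreover have "U = {(\<Sum>i<r. w i) | w. \<forall>i<r. w i \<in> ?Us i}"
  proof (intro equalityI subsetI)
    fix u
    assume u: "u \<in> U"
    have "block_proj i u \<in> ?Us i" if "i < r" for i
      using proj u that submod_sub[OF U] by (auto simp: Ablock_iff block_proj_def)
    then show "u \<in> {(\<Sum>i<r. w i) | w. \<forall>i<r. w i \<in> ?Us i}"
      using sum_block_proj[OF submod_sub[OF U u]] by (intro CollectI exI[of _ "\<lambda>i. block_proj i u"]) auto
  next
    fix u
    assume "u \<in> {(\<Sum>i<r. w i) | w. \<forall>i<r. w i \<in> ?Us i}"
    then show "u \<in> U"
      using submod_sum[OF U, of "{..<r}"] by auto
  qed
  ultimately show "homogeneous absv d \<beta> r U"
    unfolding homogeneous_def by (intro exI[of _ ?Us]) blast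
qed

text \<open>A block diagonal matrix commutes with the block projections.\<close>

lemma homogeneous_rowspan:
  assumes "x \<in> nondeg"
  shows "homogeneous absv d \<beta> r (rowspan x)"
  unfolding homogeneous_iff[OF submod_rowspan[OF assms]]
proof (intro ballI allI impI)
  fix u i
  assume "u \<in> rowspan x" and i: "i < r"
  then obtain v where v: "v \<in> free_mod {..<d}" "u = rowcomb d x v"
    by (auto simp: rowspan_def)
  have x: "x (k, b) = 0" if "in_block i k \<noteq> in_block i b" for k b
    using that i T_outside[OF nondegD(1)[OF assms], of k b] in_block_unique[OF i] mem_I_iff[of k b] by blast
  have "block_proj i u = rowcomb d x (block_proj i v)"
  proof
    fix b
    show "block_proj i u b = rowcomb d x (block_proj i v) b"
      using x[of _ b] unfolding v(2) block_proj_def rowcomb_def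
      by (cases "in_block i b") (auto intro!: sum.cong sum.neutral sum.neutral[symmetric])
  qed
  moreover have "block_proj i v \<in> free_mod {..<d}"
    using v(1) by (auto simp: free_mod_def block_proj_def)
  ultimately show "block_proj i u \<in> rowspan x"
    by (auto simp: rowspan_def)
qed

text \<open>Nonzero values are powers of 1/q with natural exponents, so a maximal value corresponds
  to a least exponent.\<close>

lemma max_absv_element:
  assumes "v0 \<in> S" "v0 k \<noteq> 0" "\<And>v. v \<in> S \<Longrightarrow> absv (v k) \<le> 1"
  obtains v where "v \<in> S" "v k \<noteq> 0" "\<And>w. w \<in> S \<Longrightarrow> absv (w k) \<le> absv (v k)"
proof -
  define e where "e v = (SOME n. absv (v k) = (1 / real q) ^ n)" for v
  have e: "absv (v k) = (1 / real q) ^ e v" if "v \<in> S" "v k \<noteq> 0" for v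
    unfolding e_def
  proof (rule someI_ex)
    show "\<exists>n. absv (v k) = (1 / real q) ^ n"
      by (rule absv_valring_eq_power[OF that(2) assms(3)[OF that(1)]]) (rule exI)
  qed
  obtain v where v: "v \<in> S \<and> v k \<noteq> 0" "\<And>w. w \<in> S \<and> w k \<noteq> 0 \<Longrightarrow> e v \<le> e w"
    using ex_has_least_nat[of "\<lambda>v. v \<in> S \<and> v k \<noteq> 0" v0 e] assms(1,2) by metis
  have "absv (w k) \<le> absv (v k)" if "w \<in> S" for w
  proof (cases "w k = 0")
    case False
    then show ?thesis
      using v(2)[of w] v(1) that q_ge_2 by (simp add: e power_decreasing)
  qed simp
  then show ?thesis
    using v(1) by (intro that[of v]) auto
qed

text \<open>Hermite normal form: the \<open>k\<close>-th row is an element of \<open>U\<close> supported on the part of the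
  block of \<open>k\<close> from \<open>k\<close> on whose leading coefficient has maximal absolute value.\<close>

lemma rowspan_exists:
  assumes U: "submod {..<d} U" and hom: "homogeneous absv d \<beta> r U" and fin: "finite (cosets absv d U)"
  obtains m where "m \<in> nondeg" "rowspan m = U"
proof -
  define S where "S k = {v \<in> U. \<forall>j. v j \<noteq> 0 \<longrightarrow> (k, j) \<in> I}" for k
  have "\<exists>v\<in>S k. v k \<noteq> 0 \<and> (\<forall>w\<in>S k. absv (w k) \<le> absv (v k))" if k: "k < d" for k
  proof -
    have "k \<in> {..<d}"
      using k by simp
    \<comment> \<open>Finite index enters here: \<open>U\<close> contains a nonzero multiple of the
      \<open>k\<close>-th basis vector, so a nonzero pivot in column \<open>k\<close>
      exists.\<close>
    obtain a where a: "a \<noteq> 0" "absv a \<le> 1" "(\<lambda>i. if i = k then a else 0) \<in> U"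
      by (rule submod_contains_multiple[OF U fin[unfolded cosets_def Acar_eq_free_mod] \<open>k \<in> {..<d}\<close>])
    have e: "(\<lambda>i. if i = k then a else 0) \<in> S k" "(\<lambda>i. if i = k then a else 0) k \<noteq> 0"
      using a mem_I_diag[OF k] by (simp_all add: S_def)
    show ?thesis
    proof (rule max_absv_element[of "\<lambda>i. if i = k then a else 0" "S k" k, OF e])
      show "absv (v k) \<le> 1" if "v \<in> S k" for v
        using that free_mod_le[OF submod_sub[OF U]] by (simp add: S_def)
    qed blast
  qed
  then obtain h where h: "\<And>k. k < d \<Longrightarrow> h k \<in> S k" "\<And>k. k < d \<Longrightarrow> h k k \<noteq> 0"
    "\<And>k w. k < d \<Longrightarrow> w \<in> S k \<Longrightarrow> absv (w k) \<le> absv (h k k)"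
    by metis
  define m where "m = (\<lambda>(k, j). if k < d then h k j else 0)"
  have hU: "h k \<in> U" if "k < d" for k
    using h(1)[OF that] by (simp add: S_def)
  have "m \<in> T"
  proof (rule free_modI)
    show "absv (m p) \<le> 1" for p
      by (cases p) (auto simp: m_def intro!: free_mod_le[OF submod_sub[OF U hU]])
    show "m p = 0" if "p \<notin> I" for p
      using h(1)[of "fst p"] that by (cases p) (auto simp: m_def S_def)
  qed
  then have m: "m \<in> nondeg"
    using h(2) by (auto simp: nondeg_def m_def)
  note W = submod_rowspan[OF m]
  have row: "h k \<in> rowspan m" if "k < d" for k
    using row_mem_rowspan[OF that, of m] that by (simp add: m_def)
  \<comment> \<open>Gaussian elimination inside one block, by induction on the number
    \<open>n\<close> of columns from \<open>k\<close> to the end of the block.\<close>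
  have red: "v \<in> rowspan m"
    if "i < r" "\<beta> i \<le> k" "k + n = \<beta> (Suc i)" "v \<in> U" "\<forall>j. v j \<noteq> 0 \<longrightarrow> k \<le> j \<and> j < \<beta> (Suc i)" for i k n v
    using that
  proof (induction n arbitrary: k v)
    case 0
    then have "v = 0"
      by (auto simp: fun_eq_iff)
    then show ?case
      using submod_0[OF W] by (simp only:)
  next
    case (Suc n)
    have ik: "in_block i k"
      using Suc.prems by (simp add: in_block_def)
    then have k: "k < d"
      using Suc.prems in_block_less_d by blast
    have kj: "(k, j) \<in> I \<longleftrightarrow> k \<le> j \<and> j < \<beta> (Suc i)" for j
      using mem_I_iff_block[OF Suc.prems(1) ik, of j] Suc.prems(2) by (auto simp: in_block_def)
    \<comment> \<open>The quotient is integral because the pivot of \<open>h k\<close> has maximal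
      absolute value; subtracting this multiple clears column \<open>k\<close> without leaving
      \<open>U\<close>.\<close>
    define a where "a = v k / h k k"
    have "v \<in> S k"
      using Suc.prems by (auto simp: S_def kj)
    then have a: "absv a \<le> 1"
      using h(2,3)[OF k] by (simp add: a_def absv_divide)
    define w where "w = v - (\<lambda>j. a * h k j)"
    have "w \<in> U"
      unfolding w_def using Suc.prems hU[OF k] a by (intro submod_diff[OF U] submod_scale[OF U])
    moreover have "\<forall>j. w j \<noteq> 0 \<longrightarrow> Suc k \<le> j \<and> j < \<beta> (Suc i)"
    proof (intro allI impI)
      fix j
      assume "w j \<noteq> 0"
      moreover have "w k = 0"
        using h(2)[OF k] by (simp add: w_def a_def)
      ultimately have "j \<noteq> k" "v j \<noteq> 0 \<or> h k j \<noteq> 0"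
        by (auto simp: w_def)
      then show "Suc k \<le> j \<and> j < \<beta> (Suc i)"
        using Suc.prems(5) h(1)[OF k] kj by (fastforce simp: S_def)
    qed
    ultimately have "w \<in> rowspan m"
      using Suc.prems by (intro Suc.IH[of "Suc k"]) auto
    then have "w + (\<lambda>j. a * h k j) \<in> rowspan m"
      using row[OF k] a by (intro submod_add[OF W] submod_scale[OF W])
    then show ?case
      by (simp add: w_def)
  qed
  have "rowspan m = U"
  proof (intro equalityI subsetI)
    fix u
    assume "u \<in> rowspan m"
    then obtain v where v: "v \<in> free_mod {..<d}" "u = rowcomb d m v"
      by (auto simp: rowspan_def)
    have "(\<lambda>b. v k * m (k, b)) \<in> U" if "k < d" for k
      using submod_scale[OF U free_mod_le[OF v(1)] hU[OF that]] that by (simp add: m_def)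
    then show "u \<in> U"
      unfolding v(2) rowcomb_eq_sum by (intro submod_sum[OF U]) auto
  next
    fix u
    assume u: "u \<in> U"
    have "block_proj i u \<in> rowspan m" if "i < r" for i
    proof (rule red[OF that])
      show "block_proj i u \<in> U"
        using hom u that homogeneous_iff[OF U] by blast
      show "\<beta> i + (\<beta> (Suc i) - \<beta> i) = \<beta> (Suc i)"
        using \<beta>_less[OF that] by simp
    qed (auto simp: block_proj_def in_block_def)
    then have "(\<Sum>i<r. block_proj i u) \<in> rowspan m"
      by (intro submod_sum[OF W]) auto
    then show "u \<in> rowspan m"
      using sum_block_proj[OF submod_sub[OF U u]] by simp
  qed
  with m show ?thesis
    by (rule that)
qed

section \<open>The divisibility conditions\<close>

lemma det_Mmat:
  assumes "x \<in> T"
  shows "Determinant.det (Mmat d x) = (\<Prod>k<d. x (k, k))"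
proof -
  have "x (i, j) = 0" if "j < i" for i j
    using T_outside[OF assms, of i j] mem_I_D[of i j] that by auto
  then have "upper_triangular (Mmat d x)"
    by (auto simp: Mmat_def)
  then have "Determinant.det (Mmat d x) = prod_list (diag_mat (Mmat d x))"
    by (rule det_upper_triangular[of _ d]) (simp add: Mmat_def)
  also have "\<dots> = (\<Prod>k<d. x (k, k))"
    by (simp add: prod_list_diag_prod Mmat_def lessThan_atLeast0)
  finally show ?thesis .
qed

lemma rowfun_Mmat:
  assumes "x \<in> T" "i < d"
  shows "rowfun d (Mmat d x) i = (\<lambda>b. x (i, b))"
proof
  fix b
  show "rowfun d (Mmat d x) i b = x (i, b)"
    using assms T_outside[OF assms(1), of i b] mem_I_D[of i b] by (auto simp: rowfun_def Mmat_def)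
qed

text \<open>Cramer's rule: the adjugate is a two-sided inverse up to the nonzero determinant, so w
  adj(x) = det(x) y is equivalent to w = y x. Divisibility says that the coordinates
  \<open>y\<close> of \<open>w\<close> in terms of the rows are integral.\<close>

lemma divisible_iff_mem_rowspan:
  assumes x: "x \<in> nondeg" and w: "\<And>b. b \<ge> d \<Longrightarrow> w b = 0"
  shows "(\<forall>k<d. \<exists>y\<in>valring absv. (\<Sum>l<d. w l * adj_mat (Mmat d x) $$ (l, k)) = Determinant.det (Mmat d x) * y)
     \<longleftrightarrow> w \<in> rowspan x"
proof
  let ?D = "Determinant.det (Mmat d x)" and ?adj = "\<lambda>l k. adj_mat (Mmat d x) $$ (l, k)"
  have car: "Mmat d x \<in> carrier_mat d d"
    by (simp add: Mmat_def)
  have D: "?D \<noteq> 0"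
    using nondegD(2)[OF x] by (simp add: det_Mmat[OF nondegD(1)[OF x]])
  have adj1: "(\<Sum>k<d. x (i, k) * ?adj k j) = (if i = j then ?D else 0)" if "i < d" "j < d" for i j
    using sum_mult_adj_mat(1)[OF car that] that by (simp add: Mmat_def)
  have adj2: "(\<Sum>k<d. ?adj i k * x (k, j)) = (if i = j then ?D else 0)" if "i < d" "j < d" for i j
    using sum_mult_adj_mat(2)[OF car that] that by (simp add: Mmat_def)
  {
    assume "\<forall>k<d. \<exists>y\<in>valring absv. (\<Sum>l<d. w l * ?adj l k) = ?D * y"
    then have "\<forall>k. \<exists>y. k < d \<longrightarrow> absv y \<le> 1 \<and> (\<Sum>l<d. w l * ?adj l k) = ?D * y"
      unfolding Bex_def valring_iff by blast
    from choice[OF this] obtain f where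
      f: "\<And>k. k < d \<Longrightarrow> absv (f k) \<le> 1" "\<And>k. k < d \<Longrightarrow> (\<Sum>l<d. w l * ?adj l k) = ?D * f k"
      by blast
    define y where "y k = (if k < d then f k else 0)" for k
    have y: "y \<in> free_mod {..<d}"
      using f(1) by (auto simp: y_def free_mod_def)
    have "w b = rowcomb d x y b" for b
    proof (cases "b < d")
      case True
      have "?D * rowcomb d x y b = (\<Sum>k<d. (?D * f k) * x (k, b))"
        by (simp add: rowcomb_def sum_distrib_left y_def mult.assoc)
      also have "\<dots> = (\<Sum>k<d. \<Sum>l<d. w l * ?adj l k * x (k, b))"
        by (intro sum.cong refl) (simp add: sum_distrib_right flip: f(2))
      also have "\<dots> = (\<Sum>l<d. \<Sum>k<d. w l * ?adj l k * x (k, b))"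
        by (rule sum.swap)
      also have "\<dots> = (\<Sum>l<d. w l * (\<Sum>k<d. ?adj l k * x (k, b)))"
        by (simp add: sum_distrib_left mult.assoc)
      also have "\<dots> = (\<Sum>l<d. w l * (if l = b then ?D else 0))"
        using True by (intro sum.cong refl) (simp add: adj2)
      also have "\<dots> = ?D * w b"
        using True by (simp add: if_distrib sum.delta' cong: if_cong)
      finally show ?thesis
        using D by simp
    next
      case False
      then show ?thesis
        using w free_mod_outside[OF rowcomb_mem[OF nondegD(1)[OF x] y], of b] by simp
    qed
    then show "w \<in> rowspan x"
      unfolding rowspan_def using y by blast
  }
  {
    assume "w \<in> rowspan x"
    then obtain y where y: "y \<in> free_mod {..<d}" "w = rowcomb d x y"
      by (auto simp: rowspan_def)
    have "(\<Sum>l<d. w l * ?adj l k) = ?D * y k" if k: "k < d" for k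
    proof -
      have "(\<Sum>l<d. w l * ?adj l k) = (\<Sum>l<d. \<Sum>i<d. y i * x (i, l) * ?adj l k)"
        by (simp add: y(2) rowcomb_def sum_distrib_right)
      also have "\<dots> = (\<Sum>i<d. \<Sum>l<d. y i * x (i, l) * ?adj l k)"
        by (rule sum.swap)
      also have "\<dots> = (\<Sum>i<d. y i * (\<Sum>l<d. x (i, l) * ?adj l k))"
        by (simp add: sum_distrib_left mult.assoc)
      also have "\<dots> = (\<Sum>i<d. y i * (if i = k then ?D else 0))"
        using k by (intro sum.cong refl) (simp add: adj1)
      also have "\<dots> = ?D * y k"
        using k by (simp add: if_distrib sum.delta' cong: if_cong)
      finally show ?thesis .
    qed
    then show "\<forall>k<d. \<exists>y\<in>valring absv. (\<Sum>l<d. w l * ?adj l k) = ?D * y"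
      using free_mod_le[OF y(1)] by auto
  }
qed

text \<open>By bilinearity, closure under multiplication can be tested on products of two rows, and
  Cramer's rule turns each such test into divisibility by the determinant.\<close>

lemma mem_Vset_iff:
  assumes x: "x \<in> nondeg"
  shows "x \<in> Vset absv d c \<beta> r \<longleftrightarrow> is_subalgebra absv d c (rowspan x)"
proof -
  note W = submod_rowspan[OF x]
  let ?w = "\<lambda>i j. mulA d c (\<lambda>b. x (i, b)) (\<lambda>b. x (j, b))"
  have "x \<in> Vset absv d c \<beta> r \<longleftrightarrow> (\<forall>i<d. \<forall>j<d. \<forall>k<d. \<exists>y\<in>valring absv.
      (\<Sum>l<d. ?w i j l * adj_mat (Mmat d x) $$ (l, k)) = Determinant.det (Mmat d x) * y)"
    using nondegD(1)[OF x] by (simp add: Vset_def Tspace_eq_free_mod Fentry_def rowfun_Mmat)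
  also have "\<dots> \<longleftrightarrow> (\<forall>i<d. \<forall>j<d. ?w i j \<in> rowspan x)"
    by (subst divisible_iff_mem_rowspan[OF x]) (auto simp: mulA_def)
  also have "\<dots> \<longleftrightarrow> is_subalgebra absv d c (rowspan x)"
  proof
    assume *: "\<forall>i<d. \<forall>j<d. ?w i j \<in> rowspan x"
    have "mulA d c u v \<in> rowspan x" if "u \<in> rowspan x" "v \<in> rowspan x" for u v
    proof -
      from that(1) obtain u' where u': "u' \<in> free_mod {..<d}" "u = rowcomb d x u'"
        by (auto simp: rowspan_def)
      from that(2) obtain v' where v': "v' \<in> free_mod {..<d}" "v = rowcomb d x v'"
        by (auto simp: rowspan_def)
      show ?thesis
        unfolding u' v' mulA_rowcomb using * free_mod_le[OF u'(1)] free_mod_le[OF v'(1)]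
        by (intro submod_sum[OF W] submod_scale[OF W]) auto
    qed
    then show "is_subalgebra absv d c (rowspan x)"
      using W by (simp add: is_subalgebra_def is_submodule_iff_submod)
  next
    assume "is_subalgebra absv d c (rowspan x)"
    then show "\<forall>i<d. \<forall>j<d. ?w i j \<in> rowspan x"
      using row_mem_rowspan unfolding is_subalgebra_def by blast
  qed
  finally show ?thesis .
qed

lemma graded_subalgebras_eq:
  "graded_subalgebras absv d c \<beta> r = rowspan ` (nondeg \<inter> Vset absv d c \<beta> r)"
proof (intro equalityI subsetI)
  fix U
  assume "U \<in> graded_subalgebras absv d c \<beta> r"
  then have U: "is_subalgebra absv d c U" "homogeneous absv d \<beta> r U" "finite (cosets absv d U)"
    by (auto simp: graded_subalgebras_def)
  then have "submod {..<d} U"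
    by (simp add: is_subalgebra_def is_submodule_iff_submod)
  then obtain m where "m \<in> nondeg" "rowspan m = U"
    using rowspan_exists U by blast
  then show "U \<in> rowspan ` (nondeg \<inter> Vset absv d c \<beta> r)"
    using U mem_Vset_iff by blast
next
  fix U
  assume "U \<in> rowspan ` (nondeg \<inter> Vset absv d c \<beta> r)"
  then show "U \<in> graded_subalgebras absv d c \<beta> r"
    using mem_Vset_iff homogeneous_rowspan card_cosets_rowspan(1) by (auto simp: graded_subalgebras_def)
qed

end

section \<open>Integration over the fibres\<close>

text \<open>Complex powers are not multiplicative in the base in general; with positive real bases
  no branch of the logarithm interferes.\<close>

lemma of_real_powr_prod:
  assumes "\<And>i. i \<in> S \<Longrightarrow> f i > 0"
  shows "complex_of_real (\<Prod>i\<in>S. f i) powr z = (\<Prod>i\<in>S. complex_of_real (f i) powr z)"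
  using assms
proof (induction S rule: infinite_finite_induct)
  case (insert i S)
  have "0 \<le> (\<Prod>j\<in>S. f j)"
    using insert.prems by (intro prod_nonneg) (auto intro: less_imp_le)
  moreover have "0 \<le> f i"
    using insert.prems[of i] by auto
  ultimately have "complex_of_real (f i * (\<Prod>j\<in>S. f j)) powr z
      = complex_of_real (f i) powr z * complex_of_real (\<Prod>j\<in>S. f j) powr z"
    unfolding of_real_mult by (intro powr_times_real) (simp_all only: Reals_of_real Re_complex_of_real)
  then show ?case
    using insert by simp
qed simp_all

lemma of_real_inverse_powr_minus:
  assumes "t > 0"
  shows "complex_of_real (inverse t) powr (- z) = complex_of_real t powr z"
proof -
  have "Ln (complex_of_real (inverse t)) = - Ln (complex_of_real t)"
    using assms by (subst (1 2) Ln_of_real) (simp_all add: ln_inverse)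
  then show ?thesis
    using assms by (simp add: powr_def)
qed

context block_structure
begin

text \<open>The index \<open>j\<close> counts columns of a block from 1 while positions count from
  0, whence \<open>\<beta> i + j - 1\<close>.\<close>

lemma prod_blocks:
  fixes f :: "nat \<Rightarrow> 'c::comm_monoid_mult"
  shows "(\<Prod>b<d. f b) = (\<Prod>i<r. \<Prod>j\<in>{1..\<beta> (Suc i) - \<beta> i}. f (\<beta> i + j - 1))"
proof -
  have "(\<Prod>b<\<beta> n. f b) = (\<Prod>i<n. \<Prod>j\<in>{1..\<beta> (Suc i) - \<beta> i}. f (\<beta> i + j - 1))" if "n \<le> r" for n
    using that
  proof (induction n)
    case 0
    show ?case
      by (simp add: \<beta>_0)
  next
    case (Suc n)
    have "{..<\<beta> (Suc n)} = {..<\<beta> n} \<union> {\<beta> n..<\<beta> (Suc n)}"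
      using \<beta>_less[of n] Suc.prems by auto
    then have "(\<Prod>b<\<beta> (Suc n). f b) = (\<Prod>b<\<beta> n. f b) * (\<Prod>b\<in>{\<beta> n..<\<beta> (Suc n)}. f b)"
      by (simp add: prod.union_disjoint ivl_disj_int)
    also have "(\<Prod>b\<in>{\<beta> n..<\<beta> (Suc n)}. f b) = (\<Prod>j\<in>{1..\<beta> (Suc n) - \<beta> n}. f (\<beta> n + j - 1))"
      by (rule prod.reindex_bij_witness[of _ "\<lambda>j. \<beta> n + j - 1" "\<lambda>b. b - \<beta> n + 1"]) auto
    finally show ?case
      using Suc by simp
  qed
  from this[of r] show ?thesis
    by (simp add: \<beta>_r)
qed

text \<open>For \<open>b = \<beta> i + j - 1\<close> this number is \<open>j\<close>, the source of
  the shift in the exponent \<open>s - j\<close>.\<close>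

lemma card_column:
  assumes "i < r" "in_block i b"
  shows "card {p \<in> I. snd p = b} = Suc (b - \<beta> i)"
proof -
  have "(a, b) \<in> I \<longleftrightarrow> a \<in> {\<beta> i..b}" for a
  proof
    assume "(a, b) \<in> I"
    then obtain j where j: "a \<le> b" "j < r" "in_block j a" "in_block j b"
      unfolding mem_I_iff by blast
    then have "j = i"
      using in_block_unique assms by blast
    then show "a \<in> {\<beta> i..b}"
      using j by (simp add: in_block_def)
  next
    assume "a \<in> {\<beta> i..b}"
    then have "a \<le> b" "in_block i a"
      using assms(2) by (auto simp: in_block_def)
    then show "(a, b) \<in> I"
      unfolding mem_I_iff using assms by blast
  qed
  note col = this
  have "{p \<in> I. snd p = b} = (\<lambda>a. (a, b)) ` {\<beta> i..b}"
  proof (intro equalityI subsetI)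
    fix p
    assume "p \<in> {p \<in> I. snd p = b}"
    then have "p = (fst p, b)" "(fst p, b) \<in> I"
      by (metis (mono_tags) mem_Collect_eq prod.collapse)+
    then show "p \<in> (\<lambda>a. (a, b)) ` {\<beta> i..b}"
      using col by blast
  next
    fix p
    assume "p \<in> (\<lambda>a. (a, b)) ` {\<beta> i..b}"
    then obtain a where "a \<in> {\<beta> i..b}" "p = (a, b)"
      by (rule imageE)
    then show "p \<in> {p \<in> I. snd p = b}"
      using col[of a] by simp
  qed
  moreover have "inj_on (\<lambda>a. (a, b)) {\<beta> i..b}"
    by (simp add: inj_on_def)
  ultimately show ?thesis
    using assms(2) by (simp add: card_image in_block_def Suc_diff_le)
qed

lemma prod_columns:
  fixes g :: "nat \<Rightarrow> 'c::comm_monoid_mult"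
  shows "(\<Prod>p\<in>I. g (snd p)) = (\<Prod>i<r. \<Prod>j\<in>{1..\<beta> (Suc i) - \<beta> i}. g (\<beta> i + j - 1) ^ j)"
proof -
  have "(\<Prod>p\<in>I. g (snd p)) = (\<Prod>b<d. \<Prod>p\<in>{p \<in> I. snd p = b}. g (snd p))"
    by (rule prod.group[symmetric]) (auto simp: finite_Tidx dest: mem_I_D)
  also have "\<dots> = (\<Prod>b<d. g b ^ card {p \<in> I. snd p = b})"
    by simp
  also have "\<dots> = (\<Prod>i<r. \<Prod>j\<in>{1..\<beta> (Suc i) - \<beta> i}. g (\<beta> i + j - 1) ^ j)"
    unfolding prod_blocks
  proof (intro prod.cong refl)
    fix i j
    assume "i \<in> {..<r}" and j: "j \<in> {1..\<beta> (Suc i) - \<beta> i}"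
    then have "card {p \<in> I. snd p = \<beta> i + j - 1} = Suc (\<beta> i + j - 1 - \<beta> i)"
      by (intro card_column) (auto simp: in_block_def)
    then show "g (\<beta> i + j - 1) ^ card {p \<in> I. snd p = \<beta> i + j - 1} = g (\<beta> i + j - 1) ^ j"
      using j by simp
  qed
  finally show ?thesis .
qed

lemma prod_diag:
  fixes a :: "'c::comm_monoid_mult"
  shows "(\<Prod>p\<in>I. if fst p = snd p then a else 1) = a ^ d"
proof -
  have "I \<inter> {p. fst p = snd p} = (\<lambda>k. (k, k)) ` {..<d}"
    using mem_I_diag by (auto dest: mem_I_D)
  then have "card (I \<inter> {p. fst p = snd p}) = d"
    by (simp add: card_image inj_on_def)
  then show ?thesis
    by (simp add: prod.If_cases finite_Tidx)
qed

lemma integrand_eq_0: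
  assumes "k < d" "x (k, k) = 0"
  shows "integrand absv \<beta> r s x = 0"
proof -
  obtain i where i: "i < r" "in_block i k"
    using in_block_exists[OF assms(1)] .
  define j where "j = k - \<beta> i + 1"
  have j: "j \<in> {1..\<beta> (Suc i) - \<beta> i}" "\<beta> i + j - 1 = k"
    using i(2) by (auto simp: j_def in_block_def)
  have "(\<Prod>j\<in>{1..\<beta> (Suc i) - \<beta> i}.
      complex_of_real (absv (x (\<beta> i + j - 1, \<beta> i + j - 1))) powr (s - of_nat j)) = 0"
    by (rule prod_zero[OF finite_atLeastAtMost bexI[OF _ j(1)]]) (simp only: j(2) assms(2) absv_0 of_real_0 powr_0)
  then show ?thesis
    unfolding integrand_def using i(1) by (intro prod_zero) auto
qed

text \<open>Grouping the second factor by columns gives |m (b, b)|^j, which cancels the shift in the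
  integrand. The product of the |m (b, b)|^s left over is a power of the inverse of the
  index.\<close>

lemma integrand_times_prod:
  assumes "m \<in> nondeg"
  shows "integrand absv \<beta> r s m * complex_of_real (\<Prod>p\<in>I. absv (m (snd p, snd p)))
    = zeta_term absv d s (rowspan m)"
proof -
  define t where "t b = absv (m (b, b))" for b
  have t: "t b > 0" if "b < d" for b
    using nondegD(2)[OF assms that] by (simp add: t_def)
  have less: "\<beta> i + j - 1 < d" if "i < r" "j \<in> {1..\<beta> (Suc i) - \<beta> i}" for i j
    using that \<beta>_le_d[of "Suc i"] by auto
  have "integrand absv \<beta> r s m * complex_of_real (\<Prod>p\<in>I. t (snd p))
      = (\<Prod>i<r. \<Prod>j\<in>{1..\<beta> (Suc i) - \<beta> i}.
          complex_of_real (t (\<beta> i + j - 1)) powr (s - of_nat j) * complex_of_real (t (\<beta> i + j - 1)) ^ j)"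
    unfolding prod_columns[of t] integrand_def by (simp only: of_real_prod of_real_power prod.distrib t_def)
  also have "\<dots> = (\<Prod>i<r. \<Prod>j\<in>{1..\<beta> (Suc i) - \<beta> i}. complex_of_real (t (\<beta> i + j - 1)) powr s)"
  proof (intro prod.cong refl)
    fix i j
    assume "i \<in> {..<r}" "j \<in> {1..\<beta> (Suc i) - \<beta> i}"
    then have "complex_of_real (t (\<beta> i + j - 1)) \<noteq> 0"
      using t[OF less, of i j] by simp
    then show "complex_of_real (t (\<beta> i + j - 1)) powr (s - of_nat j) * complex_of_real (t (\<beta> i + j - 1)) ^ j
        = complex_of_real (t (\<beta> i + j - 1)) powr s"
      by (simp add: powr_diff powr_nat')
  qed
  also have "\<dots> = (\<Prod>b<d. complex_of_real (t b) powr s)"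
    by (rule prod_blocks[symmetric])
  also have "\<dots> = complex_of_real (\<Prod>b<d. t b) powr s"
    using t by (intro of_real_powr_prod[symmetric]) auto
  also have "\<dots> = complex_of_real (inverse (\<Prod>b<d. t b)) powr (- s)"
    using t by (intro of_real_inverse_powr_minus[symmetric] prod_pos) auto
  also have "inverse (\<Prod>b<d. t b) = real (card (cosets absv d (rowspan m)))"
  proof (rule inverse_unique)
    show "(\<Prod>b<d. t b) * real (card (cosets absv d (rowspan m))) = 1"
      using card_cosets_rowspan(2)[OF assms] by (simp add: t_def mult.commute)
  qed
  finally show ?thesis
    by (simp add: zeta_term_def t_def)
qed

lemma integrand_rowmul:
  assumes "m \<in> T" "u \<in> unit_diag"
  shows "integrand absv \<beta> r s (rowmul d m u) = integrand absv \<beta> r s m"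
proof -
  have u: "u \<in> T" "\<And>k. k < d \<Longrightarrow> absv (u (k, k)) = 1"
    using assms(2) by (auto simp: unit_diag_def)
  have "absv (rowmul d m u (k, k)) = absv (m (k, k))" if "k < d" for k
    using u(2)[OF that] by (simp add: rowmul_diag[OF assms(1) u(1) that] absv_mult)
  moreover have "\<beta> i + j - 1 < d" if "i < r" "j \<in> {1..\<beta> (Suc i) - \<beta> i}" for i j
    using that \<beta>_le_d[of "Suc i"] by auto
  ultimately show ?thesis
    unfolding integrand_def by (intro prod.cong refl) auto
qed

text \<open>The matrices with unit diagonal are a union of \<open>(q - 1) ^ d\<close> cosets of those whose diagonal
  lies in the maximal ideal.\<close>

lemma unit_diag_cosets:
  obtains D1 Y where "triangular I snd D1 (\<lambda>u p. D1 p * u p)" "finite Y" "Y \<subseteq> T"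
    "card Y = (q - 1) ^ d" "(\<Prod>p\<in>I. absv (D1 p)) = (1 / real q) ^ d"
    "bij_betw (\<lambda>(y, u). y + (\<lambda>p. D1 p * u p)) (Y \<times> T) unit_diag"
proof -
  obtain R0 where R0: "reps unif R0" "card R0 = q" "0 \<in> R0"
    using reps_unif .
  \<comment> \<open>Scaling by \<open>D1\<close> maps \<open>T\<close> onto the matrices whose
    diagonal lies in the maximal ideal, other entries being arbitrary.\<close>
  define D1 where "D1 p = (if fst p = snd p then unif else 1)" for p :: "nat \<times> nat"
  define Rf where "Rf p = (if fst p = snd p then R0 else {0})" for p :: "nat \<times> nat"
  \<comment> \<open>Dropping 0 leaves \<open>q - 1\<close> choices for each diagonal entry.\<close>
  define R' where "R' p = (if fst p = snd p then R0 - {0} else {0})" for p :: "nat \<times> nat"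
  have tri: "triangular I snd D1 (\<lambda>u p. D1 p * u p)"
    using unif_nonzero absv_unif_less_1 by (intro triangular_scaling) (auto simp: D1_def)
  have reps: "reps (D1 p) (Rf p)" for p
    using R0(1) reps_unit[of 1] by (simp add: D1_def Rf_def)
  have sub: "box I R' \<subseteq> box I Rf"
    by (auto simp: box_def R'_def Rf_def split: if_splits)
  have "finite R0" "R0 \<subseteq> valring absv"
    using R0(1) by (auto simp: reps_def)
  then have R': "finite (R' p)" "R' p \<subseteq> valring absv" for p
    by (auto simp: R'_def)
  have "card (box I R') = (\<Prod>p\<in>I. card (R' p))"
    using R' by (intro card_box finite_Tidx)
  also have "\<dots> = (\<Prod>p\<in>I. if fst p = snd p then q - 1 else 1)"
    using R0 by (intro prod.cong refl) (simp add: R'_def)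
  finally have card: "card (box I R') = (q - 1) ^ d"
    by (simp add: prod_diag)
  have "(\<Prod>p\<in>I. absv (D1 p)) = (\<Prod>p\<in>I. if fst p = snd p then 1 / real q else 1)"
    by (intro prod.cong refl) (simp add: D1_def absv_unif)
  then have D1: "(\<Prod>p\<in>I. absv (D1 p)) = (1 / real q) ^ d"
    by (simp only: prod_diag)
  have less: "absv (unif * u (k, k)) < 1" if "u \<in> T" for u k
  proof -
    have "absv (unif * u (k, k)) \<le> absv unif"
      using T_le[OF that] by (simp add: absv_mult mult_left_le)
    then show ?thesis
      using absv_unif_less_1 by linarith
  qed
  \<comment> \<open>Adding a multiple of \<open>unif\<close> does not affect whether a diagonal
    entry is a unit, and 0 is the only element of \<open>R0\<close> in the maximal ideal.\<close>
  have unit_iff: "y + (\<lambda>p. D1 p * u p) \<in> unit_diag \<longleftrightarrow> y \<in> box I R'"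
    if y: "y \<in> box I Rf" and u: "u \<in> T" for y u
  proof -
    have yT: "y \<in> T"
      using y by (simp add: box_def)
    have "absv (y (k, k) + unif * u (k, k)) = 1 \<longleftrightarrow> y (k, k) \<noteq> 0" if k: "k < d" for k
    proof -
      have yR: "y (k, k) \<in> R0"
        using y mem_I_diag[OF k] by (force simp: box_def Rf_def)
      have "absv (y (k, k) + unif * u (k, k)) < 1 \<longleftrightarrow> absv (y (k, k)) < 1"
        using less[OF u, of k] absv_add_le[of "y (k, k)" "1 / real q" "unif * u (k, k)"]
          absv_diff_le[of "y (k, k) + unif * u (k, k)" "1 / real q" "unif * u (k, k)"]
        by (auto simp: absv_less_1_iff)
      also have "\<dots> \<longleftrightarrow> y (k, k) = 0"
        using reps_unique[OF R0(1) yR R0(3)] by (auto simp: absv_less_1_iff absv_unif)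
      finally show ?thesis
        using absv_add_le[of "y (k, k)" 1 "unif * u (k, k)"] T_le[OF yT, of "(k, k)"] less[OF u, of k]
        by auto
    qed
    then have "y + (\<lambda>p. D1 p * u p) \<in> unit_diag \<longleftrightarrow> (\<forall>k<d. y (k, k) \<noteq> 0)"
      using free_mod_add[OF yT triangular_mem[OF tri u]] by (auto simp: unit_diag_def D1_def)
    also have "\<dots> \<longleftrightarrow> y \<in> box I R'"
    proof
      assume *: "\<forall>k<d. y (k, k) \<noteq> 0"
      have "y p \<in> R' p" if "p \<in> I" for p
        using y that * mem_I_D[of "fst p" "snd p"]
        by (cases p) (auto simp: box_def R'_def Rf_def split: if_splits)
      then show "y \<in> box I R'"
        using yT by (simp add: box_def)
    next
      assume *: "y \<in> box I R'"
      show "\<forall>k<d. y (k, k) \<noteq> 0"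
      proof (intro allI impI)
        fix k
        assume "k < d"
        then have "y (k, k) \<in> R' (k, k)"
          using * mem_I_diag by (simp add: box_def)
        then show "y (k, k) \<noteq> 0"
          by (simp add: R'_def)
      qed
    qed
    finally show ?thesis .
  qed
  show ?thesis
  proof (rule that[OF tri _ _ card D1])
    show "finite (box I R')"
      using R' by (intro finite_box finite_Tidx)
    show "box I R' \<subseteq> T"
      by (auto simp: box_def)
    show "bij_betw (\<lambda>(y, u). y + (\<lambda>p. D1 p * u p)) (box I R' \<times> T) unit_diag"
      unfolding bij_betw_def
    proof (intro conjI inj_onI equalityI subsetI)
      fix z
      assume z: "z \<in> unit_diag"
      then have zT: "z \<in> T"
        by (simp add: unit_diag_def)
      obtain y u where yu: "y \<in> box I Rf" "u \<in> T" "z = y + (\<lambda>p. D1 p * u p)"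
        by (rule triangular_decompose[OF tri finite_Tidx reps zT])
      then have "(y, u) \<in> box I R' \<times> T"
        using unit_iff[OF yu(1,2)] z by simp
      then show "z \<in> (\<lambda>(y, u). y + (\<lambda>p. D1 p * u p)) ` (box I R' \<times> T)"
        by (rule rev_image_eqI) (simp only: yu(3) prod.case)
    next
      fix z
      assume "z \<in> (\<lambda>(y, u). y + (\<lambda>p. D1 p * u p)) ` (box I R' \<times> T)"
      then obtain y u where "y \<in> box I R'" "u \<in> T" "z = y + (\<lambda>p. D1 p * u p)"
        by (elim imageE SigmaE) (simp only: prod.case)
      then show "z \<in> unit_diag"
        using unit_iff[of y u] sub by blast
    next
      fix a b
      assume a: "a \<in> box I R' \<times> T" and b: "b \<in> box I R' \<times> T"
        and eq: "(case a of (y, u) \<Rightarrow> y + (\<lambda>p. D1 p * u p)) = (case b of (y, u) \<Rightarrow> y + (\<lambda>p. D1 p * u p))"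
      obtain y u y' u' where ab: "a = (y, u)" "b = (y', u')"
        by (cases a, cases b)
      have "y = y' \<and> u = u'"
        using a b eq sub unfolding ab prod.case
        by (intro triangular_unique[OF tri reps]) auto
      then show "a = b"
        by (simp add: ab)
    qed
  qed
qed

end

context haar_measure
begin

text \<open>The tiling of \<open>unit_diag\<close> is transported by right multiplication with
  \<open>m\<close>. The \<open>(q - 1) ^ d\<close> tiles become translates of the image of the
  composite map, and \<open>D1\<close> contributes the factor q^-d, which together give (1 -
  1/q)^d.\<close>

lemma measure_fibre:
  assumes m: "m \<in> nondeg"
  shows "rowmul d m ` unit_diag \<in> sets M"
    "measure M (rowmul d m ` unit_diag) = (1 - 1 / real q) ^ d * (\<Prod>p\<in>I. absv (m (snd p, snd p)))"
proof -
  let ?L = "rowmul d m"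
  note tri = triangular_rowmul[OF m]
  obtain D1 Y where tri1: "triangular I snd D1 (\<lambda>u p. D1 p * u p)" and Y: "finite Y" "Y \<subseteq> T"
    "card Y = (q - 1) ^ d" and D1: "(\<Prod>p\<in>I. absv (D1 p)) = (1 / real q) ^ d"
    and bij: "bij_betw (\<lambda>(y, u). y + (\<lambda>p. D1 p * u p)) (Y \<times> T) unit_diag"
    by (rule unit_diag_cosets)
  define L1 where "L1 u = (\<lambda>p. D1 p * u p)" for u
  have tri1: "triangular I snd D1 L1"
    using tri1 unfolding L1_def .
  note tri2 = triangular_comp[OF tri tri1]
  have fib: "?L ` unit_diag = (\<Union>y\<in>?L ` Y. (\<lambda>v. v + y) ` (?L \<circ> L1) ` T)"
  proof -
    have "unit_diag = (\<lambda>(y, u). y + L1 u) ` (Y \<times> T)"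
      using bij by (simp add: bij_betw_def L1_def)
    also have "\<dots> = (\<Union>y\<in>Y. (\<lambda>u. y + L1 u) ` T)"
      by auto
    finally show ?thesis
      by (simp add: image_UN image_image triangular_add[OF tri] add.commute)
  qed
  \<comment> \<open>Injectivity of right multiplication by \<open>m\<close> carries the disjointness
    of the tiles of \<open>unit_diag\<close> over to their images.\<close>
  have disj2: "y = y'" if y: "y \<in> ?L ` Y" "y' \<in> ?L ` Y" and u: "u \<in> T" "u' \<in> T"
    and eq: "y + (?L \<circ> L1) u = y' + (?L \<circ> L1) u'" for y y' u u'
  proof -
    obtain w w' where w: "w \<in> Y" "y = ?L w" "w' \<in> Y" "y' = ?L w'"
      using y by blast
    have "?L (w + L1 u) = ?L (w' + L1 u')"
      using eq by (simp add: w(2,4) triangular_add[OF tri])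
    moreover have "w + L1 u \<in> T" "w' + L1 u' \<in> T"
      using w(1,3) u Y(2) triangular_mem[OF tri1] by (auto intro: free_mod_add)
    ultimately have "w + L1 u = w' + L1 u'"
      using triangular_inj[OF tri] by (simp add: inj_on_def)
    then have "(w, u) = (w', u')"
      using w(1,3) u by (intro inj_onD[OF bij_betw_imp_inj_on[OF bij]]) (auto simp: L1_def)
    then show ?thesis
      using w by simp
  qed
  have LY: "finite (?L ` Y)" "?L ` Y \<subseteq> T"
    using Y triangular_mem[OF tri] by auto
  show "?L ` unit_diag \<in> sets M"
    unfolding fib by (rule measure_disjoint_translates(1)[OF tri2 LY disj2])
  have card: "card (?L ` Y) = (q - 1) ^ d"
    using Y inj_on_subset[OF triangular_inj[OF tri] Y(2)] by (simp add: card_image)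
  have "measure M (?L ` unit_diag) = real (card (?L ` Y)) * measure M ((?L \<circ> L1) ` T)"
    unfolding fib by (rule measure_disjoint_translates(2)[OF tri2 LY disj2])
  also have "\<dots> = real ((q - 1) ^ d) * (\<Prod>p\<in>I. absv (m (snd p, snd p) * D1 p))"
    by (simp only: card measure_image[OF tri2])
  also have "\<dots> = (real (q - 1) * (1 / real q)) ^ d * (\<Prod>p\<in>I. absv (m (snd p, snd p)))"
    by (simp only: absv_mult prod.distrib D1 power_mult_distrib of_nat_power mult_ac)
  also have "real (q - 1) * (1 / real q) = 1 - 1 / real q"
    using q_ge_2 by (simp add: of_nat_diff field_simps)
  finally show "measure M (?L ` unit_diag) = (1 - 1 / real q) ^ d * (\<Prod>p\<in>I. absv (m (snd p, snd p)))" .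
qed

lemma integral_fibre:
  assumes m: "m \<in> nondeg"
  shows "(LINT x:rowmul d m ` unit_diag|M. integrand absv \<beta> r s x)
    = (1 - 1 / of_nat q) ^ d * zeta_term absv d s (rowspan m)"
proof -
  note F = measure_fibre[OF m]
  have "(LINT x:rowmul d m ` unit_diag|M. integrand absv \<beta> r s x)
      = (LINT x:rowmul d m ` unit_diag|M. integrand absv \<beta> r s m)"
    using F(1) integrand_rowmul[OF nondegD(1)[OF m]] by (intro set_lebesgue_integral_cong) auto
  also have "\<dots> = measure M (rowmul d m ` unit_diag) *\<^sub>R integrand absv \<beta> r s m"
    using F(1) by (intro set_integral_const) (auto simp: M.emeasure_finite)
  also have "\<dots> = (1 - 1 / of_nat q) ^ d *
      (integrand absv \<beta> r s m * complex_of_real (\<Prod>p\<in>I. absv (m (snd p, snd p))))"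
    by (simp add: F(2) scaleR_conv_of_real)
  finally show ?thesis
    by (simp only: integrand_times_prod[OF m])
qed

lemma zeta_eq_integral:
  assumes summable: "zeta_term absv d s summable_on graded_subalgebras absv d c \<beta> r"
    and integrable: "set_integrable M (Vset absv d c \<beta> r) (integrand absv \<beta> r s)"
  shows "(LINT x:Vset absv d c \<beta> r|M. integrand absv \<beta> r s x)
    = (1 - 1 / of_nat q) ^ d * (\<Sum>\<^sub>\<infinity>U\<in>graded_subalgebras absv d c \<beta> r. zeta_term absv d s U)"
proof -
  define G where "G = graded_subalgebras absv d c \<beta> r"
  define V where "V = Vset absv d c \<beta> r"
  define \<zeta> where "\<zeta> = zeta_term absv d s"
  define f where "f = integrand absv \<beta> r s"
  define C :: complex where "C = (1 - 1 / of_nat q) ^ d"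
  define fib where "fib U = {x \<in> nondeg. rowspan x = U}" for U
  have G: "G = rowspan ` (nondeg \<inter> V)"
    unfolding G_def V_def by (rule graded_subalgebras_eq)
  have fib: "fib U \<in> sets M \<and> (LINT x:fib U|M. f x) = C * \<zeta> U" if U: "U \<in> G" for U
  proof -
    obtain m where m: "m \<in> nondeg" "U = rowspan m"
      using U unfolding G by blast
    have "fib U = rowmul d m ` unit_diag"
      unfolding fib_def m(2) by (rule rowspan_eq_iff[OF m(1)])
    then show ?thesis
      using measure_fibre(1)[OF m(1)] integral_fibre[OF m(1)] by (simp add: f_def C_def \<zeta>_def m(2))
  qed
  have sub: "fib U \<subseteq> V" if "U \<in> G" for U
  proof
    fix x
    assume x: "x \<in> fib U"
    then have "is_subalgebra absv d c (rowspan x)"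
      using that by (auto simp: fib_def G_def graded_subalgebras_def)
    then show "x \<in> V"
      using x mem_Vset_iff by (simp add: fib_def V_def)
  qed
  \<comment> \<open>A finite index is a positive number, so its complex power is nonzero. A summable
    family has only countably many nonzero terms, hence \<open>G\<close> is countable.\<close>
  have nz: "\<zeta> U \<noteq> 0" if U: "U \<in> G" for U
  proof -
    obtain m where m: "m \<in> nondeg" "U = rowspan m"
      using U unfolding G by blast
    then have "card (cosets absv d U) \<noteq> 0"
      using card_cosets_rowspan(2)[OF m(1)] by (metis mult_zero_left of_nat_0 zero_neq_one)
    then show ?thesis
      by (simp add: \<zeta>_def zeta_term_def)
  qed
  have "countable {U \<in> G. \<zeta> U \<noteq> 0}"
    using summable unfolding \<zeta>_def G_def by (rule summable_countable_complex)
  also have "{U \<in> G. \<zeta> U \<noteq> 0} = G"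
    using nz by blast
  finally have count: "countable G" .
  define e where "e = to_nat_on G"
  define e' where "e' = from_nat_into G"
  have e: "inj_on e G" "\<And>U. U \<in> G \<Longrightarrow> e' (e U) = U"
    using count by (auto simp: e_def e'_def)
  \<comment> \<open>The fibres are indexed by natural numbers for countable additivity; numbers that
    encode no subalgebra get the empty set, which also covers finite \<open>G\<close>.\<close>
  define A where "A n = (if n \<in> e ` G then fib (e' n) else {})" for n
  have A_sets: "A n \<in> sets M" for n
    using fib e(2) by (auto simp: A_def)
  have A_disj: "A n \<inter> A k = {}" if "n \<noteq> k" for n k
    using that e by (auto simp: A_def fib_def)
  have "(\<Union>n. A n) = (\<Union>U\<in>G. fib U)"
    using e(2) by (force simp: A_def)
  also have "\<dots> = nondeg \<inter> V"
    using sub by (auto simp: fib_def G)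
  finally have UA: "(\<Union>n. A n) = nondeg \<inter> V" .
  \<comment> \<open>The integrand vanishes on the degenerate part of \<open>V\<close>, so
    multiplying it with the indicator of \<open>V\<close> or of the union of the fibres gives the
    same function. Integral and integrability both pass from \<open>V\<close> to the union in this
    way.\<close>
  have zero: "f x = 0" if "x \<in> V" "x \<notin> nondeg" for x
    using that integrand_eq_0 by (auto simp: nondeg_def f_def V_def Vset_def Tspace_eq_free_mod)
  have ind: "indicator V x *\<^sub>R f x = indicator (\<Union>n. A n) x *\<^sub>R f x" for x
    unfolding UA using zero[of x] by (auto simp: indicator_def)
  have int: "set_integrable M (\<Union>n. A n) f"
    using integrable unfolding set_integrable_def V_def[symmetric] f_def[symmetric] ind .
  have "(LINT x:V|M. f x) = (LINT x:(\<Union>n. A n)|M. f x)"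
    unfolding set_lebesgue_integral_def ind ..
  also have "\<dots> = (\<Sum>n. LINT x:A n|M. f x)"
    using A_sets A_disj int by (rule lebesgue_integral_countable_add)
  also have "(\<lambda>n. LINT x:A n|M. f x) = (\<lambda>n. C * (if n \<in> e ` G then \<zeta> (e' n) else 0))"
    using fib e(2) by (auto simp: A_def fun_eq_iff set_lebesgue_integral_def)
  also have "(\<lambda>n. C * (if n \<in> e ` G then \<zeta> (e' n) else 0)) sums (C * infsum \<zeta> G)"
  proof (rule sums_mult)
    have "(\<zeta> has_sum infsum \<zeta> G) G"
      using summable unfolding \<zeta>_def G_def by (rule has_sum_infsum)
    then have "((\<lambda>n. \<zeta> (e' n)) \<circ> e has_sum infsum \<zeta> G) G"
      by (rule has_sum_cong[THEN iffD1, rotated]) (simp add: e(2))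
    then have "((\<lambda>n. \<zeta> (e' n)) has_sum infsum \<zeta> G) (e ` G)"
      by (simp only: has_sum_reindex[OF e(1)])
    then have "((\<lambda>n. if n \<in> e ` G then \<zeta> (e' n) else 0) has_sum infsum \<zeta> G) UNIV"
      by (rule has_sum_cong_neutral[THEN iffD1, rotated -1]) auto
    then show "(\<lambda>n. if n \<in> e ` G then \<zeta> (e' n) else 0) sums infsum \<zeta> G"
      by (rule has_sum_imp_sums)
  qed
  from sums_unique[OF this] have "(\<Sum>n. C * (if n \<in> e ` G then \<zeta> (e' n) else 0)) = C * infsum \<zeta> G"
    by simp
  finally show ?thesis
    by (simp add: V_def f_def C_def \<zeta>_def G_def)
qed

end

theorem mainTheorem1:
  fixes absv :: "'k::field \<Rightarrow> real" and q d r :: nat and \<beta> :: "nat \<Rightarrow> nat"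
    and c :: "nat \<Rightarrow> nat \<Rightarrow> nat \<Rightarrow> 'k" and M :: "(nat \<times> nat \<Rightarrow> 'k) measure"
    and s :: complex
  assumes "nonarch_local_field absv q"
    and "\<forall>i<d. \<forall>j<d. \<forall>k<d. c i j k \<in> valring absv"
    and "r \<ge> 1" and "\<beta> 0 = 0" and "\<forall>i<r. \<beta> i < \<beta> (Suc i)" and "\<beta> r = d"
    and "is_haar absv d \<beta> r M"
    and "zeta_term absv d s summable_on graded_subalgebras absv d c \<beta> r"
    and "set_integrable M (Vset absv d c \<beta> r) (integrand absv \<beta> r s)"
  shows "(\<Sum>\<^sub>\<infinity>U\<in>graded_subalgebras absv d c \<beta> r. zeta_term absv d s U)
         = inverse ((1 - 1 / of_nat q) ^ d)
           * (LINT x:Vset absv d c \<beta> r|M. integrand absv \<beta> r s x)"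
proof -
  interpret haar_measure absv q d r \<beta> M
    using assms by unfold_locales auto
  have "of_nat q \<noteq> (1 :: complex)"
    using q_ge_2 by auto
  then have "(1 - 1 / of_nat q :: complex) ^ d \<noteq> 0"
    using q_ge_2 by (auto simp: field_simps)
  then show ?thesis
    by (simp add: zeta_eq_integral[OF assms(8,9)])
qed

end
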